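(* Let $n\geq 1$ be an integer, let $\lambda_{0},\ldots,\lambda_{n-1}\in[2,\infty]$, and let $\mu_{0},\ldots,\mu_{n-1}$ satisfy $\mu_{i}\geq\lambda_{i}$ and \[ \mu_{i}>\frac{\Lambda}{\lambda_{i}-1}+1,\qquad 0\leq i\leq n-1, \] where $\Lambda=\lambda_{0}\lambda_{1}\cdots\lambda_{n-1}$. Then \[ n-1+\frac{2}{\max_{0\leq i\leq n-1}\lambda_{i}}\;\geq\;\dim\Big(\prod_{i=0}^{n-1}\mathscr{W}_{\lambda_{i};\mu_{i}}\Big)\;\geq\;\max\Big\{n-1,\ 2\sum_{i=0}^{n-1}\lambda_{i}^{-1}\Big\}. \]
   Context: $\dim$ denotes Hausdorff dimension. For $\xi\in\mathbb{R}$, the irrationality exponent $\mu(\xi)$ is the supremum of all $\mu$ such that $|\xi-p/q|\leq q^{-\mu}$ has infinitely many rational solutions $p/q$ ($q\geq 1$). For $2\leq\lambda\leq\mu\leq\infty$, $\mathscr{W}_{\lambda;\mu}=\{\xi\in\mathbb{R}:\lambda\leq\mu(\xi)\leq\mu\}$. *)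

theory Defs
  imports "HOL-Analysis.Analysis"
begin

text \<open>
  The weight \<open>(diam U)\<^sup>s\<close> with the usual conventions \<open>(diam {})\<^sup>s = 0\<close> and \<open>0\<^sup>0 = 1\<close> for
  nonempty \<open>U\<close>; the case \<open>s = 0\<close> is separated because \<open>0 powr 0 = 0\<close> in HOL.
\<close>

definition diam_weight :: "real \<Rightarrow> 'a::metric_space set \<Rightarrow> ennreal" where
  "diam_weight s U =
     (if U = {} then 0 else if s = 0 then 1 else ennreal (diameter U powr s))"

text \<open>
  Boundedness is required explicitly, since \<open>diameter\<close> carries no information on unbounded sets.
  Finite covers are included by padding with empty sets.
\<close>

definition hausdorff_premeasure :: "real \<Rightarrow> real \<Rightarrow> 'a::metric_space set \<Rightarrow> ennreal" where
  "hausdorff_premeasure s \<delta> A =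
     (INF U \<in> {U :: nat \<Rightarrow> 'a set. A \<subseteq> (\<Union>i. U i) \<and> (\<forall>i. bounded (U i) \<and> diameter (U i) \<le> \<delta>)}.
        \<Sum>i. diam_weight s (U i))"

definition hausdorff_measure :: "real \<Rightarrow> 'a::metric_space set \<Rightarrow> ennreal" where
  "hausdorff_measure s A = (SUP \<delta> \<in> {0<..}. hausdorff_premeasure s \<delta> A)"

definition hausdorff_dim :: "'a::metric_space set \<Rightarrow> ereal" where
  "hausdorff_dim A = Inf (ereal ` {s. 0 \<le> s \<and> hausdorff_measure s A = 0})"

text \<open>
  Solutions are counted as rational numbers, not as pairs \<open>(p, q)\<close>; thus a rational number
  \<open>\<xi>\<close> has exponent \<open>1\<close>, not \<open>\<infinity>\<close>.
\<close>

definition irrationality_exponent :: "real \<Rightarrow> ereal" where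
  "irrationality_exponent \<xi> =
     Sup (ereal ` {m :: real. infinite {real_of_int p / real q | (p :: int) (q :: nat).
            q \<ge> 1 \<and> \<bar>\<xi> - real_of_int p / real q\<bar> \<le> real q powr (- m)}})"

definition exponent_class :: "ereal \<Rightarrow> ereal \<Rightarrow> real set" where
  "exponent_class a b = {\<xi>. a \<le> irrationality_exponent \<xi> \<and> irrationality_exponent \<xi> \<le> b}"

end

theory Submission
  imports Defs "HOL-Probability.Probability" "HOL-Real_Asymp.Real_Asymp"
begin

text \<open>
  Upper bound: if \<open>x $ i\<close> has exponent larger than \<open>m\<close>, then \<open>x\<close> lies in infinitely many slabs of width
  \<open>q powr (- m)\<close> about the hyperplanes \<open>x $ i = p / q\<close>; cutting these slabs into cubes gives a cover of
  dimension \<open>n - 1 + 2 / m\<close>.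

  Lower bound \<open>n - 1\<close>: every \<open>y\<close> has a shift \<open>y - t * (1,\<dots>,1)\<close> with \<open>t \<in> [0,1]\<close> in the product set, so the
  product set swept along the diagonal is the whole space. The number \<open>t\<close> comes from nested intervals which
  serve the coordinates cyclically: in step \<open>k\<close> the coordinate \<open>y $ i - t\<close> gets a rational approximation with
  denominator \<open>Q k\<close> and error of exact order \<open>Q k powr (- l i)\<close>, and \<open>Q (k + 1)\<close> is comparable to
  \<open>Q k powr l i\<close>. The approximation denominators of a fixed coordinate thus grow with exponent \<open>\<Lambda>\<close>, and
  comparison with these good approximations shows that the exponent does not exceed
  \<open>max (l i) (\<Lambda> / (l i - 1) + 1)\<close>.

  Lower bound \<open>2 * \<Sum> 1 / l i\<close>: on the numbers of exponent at least \<open>\<lambda>\<close> there is a probability measure giving mass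
  at most \<open>C * r powr s\<close> to intervals of length \<open>r\<close>, for all \<open>s < 2 / \<lambda>\<close> simultaneously. By Borel--Cantelli almost
  every point then has exponent exactly \<open>\<lambda>\<close>. The product of these measures obeys the mass distribution principle.

  An infinite \<open>l i\<close> forces all of them to be infinite, since otherwise the hypothesis on \<open>u\<close> fails.
\<close>

subsection \<open>Farey fractions\<close>

definition farey :: "nat \<Rightarrow> real set" where
  "farey Q = {real_of_int p / real q | p q. 1 \<le> q \<and> q \<le> Q}"

text \<open>Over the common denominator \<open>q * q'\<close> the numerator of the difference is a
  nonzero integer.\<close>

lemma distinct_fractions_dist:
  fixes p p' :: int and q q' :: nat
  assumes "q \<ge> 1" "q' \<ge> 1" and ne: "real_of_int p / q \<noteq> real_of_int p' / q'"
  shows "\<bar>real_of_int p / q - real_of_int p' / q'\<bar> \<ge> 1 / (real q * real q')"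
proof -
  have "real_of_int p / q - real_of_int p' / q' = real_of_int (p * q' - p' * q) / (real q * real q')"
    using assms by (simp add: field_simps)
  moreover from this ne have "p * q' - p' * q \<noteq> 0" by force
  then have "\<bar>p * q' - p' * q\<bar> \<ge> 1" by linarith
  then have "\<bar>real_of_int (p * q' - p' * q)\<bar> \<ge> 1" by linarith
  ultimately show ?thesis
    using assms by (simp add: abs_divide divide_right_mono)
qed

lemma farey_separated:
  assumes "r \<in> farey Q" "r' \<in> farey Q" "r \<noteq> r'"
  shows "1 / (real Q)\<^sup>2 \<le> \<bar>r - r'\<bar>"
proof -
  obtain p q p' q' where r: "r = real_of_int p / real q" "1 \<le> q" "q \<le> Q"
    "r' = real_of_int p' / real q'" "1 \<le> q'" "q' \<le> Q"
    using assms unfolding farey_def by blast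
  have "1 / (real Q)\<^sup>2 \<le> 1 / (real q * real q')"
    using r by (intro divide_left_mono) (auto simp: power2_eq_square intro!: mult_mono mult_pos_pos)
  also have "\<dots> \<le> \<bar>r - r'\<bar>"
    using distinct_fractions_dist[of q q' p p'] r assms by simp
  finally show ?thesis .
qed

lemma int_interval_card:
  fixes x w :: real assumes "w \<ge> 0"
  shows "finite {p::int. x \<le> p \<and> p \<le> x + w}" "real (card {p::int. x \<le> p \<and> p \<le> x + w}) \<le> w + 1"
proof -
  have eq: "{p::int. x \<le> p \<and> p \<le> x + w} = {\<lceil>x\<rceil>..\<lfloor>x + w\<rfloor>}"
    by (auto simp: ceiling_le_iff le_floor_iff)
  show "finite {p::int. x \<le> p \<and> p \<le> x + w}" unfolding eq by simp
  have "real_of_int (\<lfloor>x + w\<rfloor> - \<lceil>x\<rceil>) \<le> w" by linarith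
  then show "real (card {p::int. x \<le> p \<and> p \<le> x + w}) \<le> w + 1"
    unfolding eq using assms by simp
qed

text \<open>The points lie in distinct cells of length \<open>d\<close>, so rounding
  \<open>(s - x) / d\<close> down is injective into the integers of
  \<open>[0, w / d]\<close>.\<close>

lemma separated_card_le:
  fixes S :: "real set"
  assumes S: "S \<subseteq> {x..x + w}" and w: "w \<ge> 0" and d: "d > 0"
    and sep: "\<And>s t. s \<in> S \<Longrightarrow> t \<in> S \<Longrightarrow> s \<noteq> t \<Longrightarrow> d \<le> \<bar>s - t\<bar>"
  shows "finite S" "real (card S) \<le> w / d + 1"
proof -
  let ?f = "\<lambda>s. \<lfloor>(s - x) / d\<rfloor>" and ?B = "{p::int. 0 \<le> real_of_int p \<and> p \<le> 0 + w / d}"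
  have inj: "inj_on ?f S"
  proof (rule inj_onI, rule ccontr)
    fix s t assume st: "s \<in> S" "t \<in> S" "?f s = ?f t" "s \<noteq> t"
    have "\<bar>(s - x) / d - (t - x) / d\<bar> < 1" using st(3) by linarith
    moreover have "(s - x) / d - (t - x) / d = (s - t) / d" by (simp add: diff_divide_distrib)
    ultimately have "\<bar>s - t\<bar> < d" using d by (simp add: abs_divide)
    with sep[OF st(1,2,4)] show False by simp
  qed
  have im: "?f ` S \<subseteq> ?B"
  proof clarify
    fix s assume "s \<in> S"
    then have "0 \<le> (s - x) / d" "(s - x) / d \<le> w / d" using S d by (auto intro!: divide_right_mono)
    then show "0 \<le> real_of_int (?f s) \<and> real_of_int (?f s) \<le> 0 + w / d" by (simp add: floor_le_iff) linarith
  qed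
  have B: "finite ?B" "real (card ?B) \<le> w / d + 1"
    using int_interval_card[of "w / d" 0] w d by auto
  show "finite S" using finite_imageD[OF finite_subset[OF im B(1)] inj] .
  have "card S \<le> card ?B" using card_inj_on_le[OF inj im B(1)] .
  with B(2) show "real (card S) \<le> w / d + 1" by linarith
qed

text \<open>A crude substitute for the logarithmic bound: by the arithmetic-geometric mean
  inequality \<open>sqrt (M + 1)\<close> exceeds \<open>sqrt M\<close> by at least
  \<open>1 / (2 * sqrt (M + 1))\<close>. Divided by \<open>Q\<close>, it still tends to zero, which
  is what \<open>farey_count\<close> uses.\<close>

lemma sum_inverse_le_sqrt: "(\<Sum>q=1..M. 1 / real q) \<le> 2 * sqrt M"
proof (induction M)
  case (Suc M)
  have "sqrt (Suc M) * sqrt M \<le> ((sqrt (Suc M))\<^sup>2 + (sqrt M)\<^sup>2) / 2"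
    using sum_squares_bound[of "sqrt (Suc M)" "sqrt M"] by simp
  then have "sqrt (Suc M) * sqrt M \<le> Suc M - 1/2" by simp
  then have "2 * sqrt M * sqrt (Suc M) + 1 \<le> 2 * (sqrt (Suc M) * sqrt (Suc M))" by (simp add: algebra_simps)
  then have "2 * sqrt M + 1 / sqrt (Suc M) \<le> 2 * sqrt (Suc M)"
    by (simp add: field_simps)
  moreover have "1 / real (Suc M) \<le> 1 / sqrt (Suc M)"
    using real_sqrt_le_iff[of "real (Suc M)" "(real (Suc M))\<^sup>2"]
    by (intro divide_left_mono) (auto simp: power2_eq_square simp del: real_sqrt_le_iff)
  ultimately show ?case using Suc by simp
qed simp

lemma interval_fmeasurable: "{a..b::real} \<in> fmeasurable lborel" "{a..<b} \<in> fmeasurable lborel"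
proof -
  show 1: "{a..b} \<in> fmeasurable lborel"
    by (auto intro!: fmeasurableI simp: emeasure_lborel_Icc_eq)
  show "{a..<b} \<in> fmeasurable lborel" by (rule fmeasurableI2[OF 1]) auto
qed

text \<open>By Dirichlet's theorem the intervals of radius \<open>1 / (q * Q)\<close> about \<open>p / q\<close> with \<open>q \<le> Q\<close> cover the line.
  Those with \<open>q \<le> Q / 32\<close> cover only a small proportion, and each other one has length at most \<open>64 / Q\<^sup>2\<close>.\<close>

lemma farey_count:
  assumes L: "0 < L" and Q: "64 \<le> L * sqrt Q"
  shows "finite (farey Q \<inter> {a..a + L})" "L * (real Q)\<^sup>2 / 256 \<le> card (farey Q \<inter> {a..a + L})"
proof -
  let ?R = "farey Q \<inter> {a..a + L}"
  have Q0: "Q > 0" using Q by (cases "Q = 0") auto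
  then have Q1: "sqrt Q \<ge> 1" by simp
  have "sqrt Q * 1 \<le> sqrt Q * sqrt Q" using Q1 by (intro mult_left_mono) auto
  then have "L * sqrt Q \<le> L * Q" using L by (intro mult_left_mono) auto
  with Q have LQ: "64 \<le> L * Q" by linarith
  show fin: "finite ?R"
    by (rule separated_card_le(1)[of _ a L "1 / (real Q)\<^sup>2"])
       (use L Q0 farey_separated in auto)
  define M where "M = nat \<lfloor>real Q / 32\<rfloor>"
  have M: "real M \<le> Q / 32" "Q / 32 < M + 1" unfolding M_def by linarith+
  define P where "P q = {p::int. a * real q \<le> p \<and> p \<le> a * real q + L * real q}" for q :: nat
  have P: "finite (P q)" "card (P q) \<le> L * real q + 1" for q
    using int_interval_card[of "L * real q" "a * real q"] L unfolding P_def by auto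
  define B where "B q p = {real_of_int p / real q - 1/(real q*Q) .. real_of_int p / real q + 1/(real q*Q)}" for q :: nat and p
  define U where "U = (\<Union>q\<in>{1..M}. \<Union>p\<in>P q. B q p)"
  define V where "V = (\<Union>r\<in>?R. {r - 32 / (real Q)\<^sup>2 .. r + 32 / (real Q)\<^sup>2})"
  \<comment> \<open>Only the middle half is covered, so that a Dirichlet fraction, which is closer
    than \<open>L / 4\<close>, cannot leave \<open>{a..a + L}\<close>.\<close>
  have cover: "{a + L/4..a + 3*L/4} \<subseteq> U \<union> V"
  proof
    fix x assume x: "x \<in> {a + L/4..a + 3*L/4}"
    obtain h k where k: "0 < k" "k \<le> int Q" "\<bar>of_int k * x - of_int h\<bar> < 1/Q"
      using Dirichlet_approx[OF Q0] by metis
    define q where "q = nat k"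
    have q: "1 \<le> q" "q \<le> Q" "k = int q" using k by (auto simp: q_def)
    have "real q * x - h = real q * (x - h / q)"
      using q by (simp add: field_simps)
    then have "\<bar>real q * x - h\<bar> = real q * \<bar>x - h / q\<bar>"
      by (simp add: abs_mult)
    then have near: "\<bar>x - h / q\<bar> < 1 / (real q * Q)"
      using k(3) q by (simp add: field_simps)
    also have "1 / (real q * Q) \<le> 1 / Q"
      using q Q0 by (simp add: field_simps)
    also have "\<dots> \<le> L / 4" using LQ Q0 by (simp add: field_simps)
    finally have close: "\<bar>x - h / q\<bar> < L / 4" .
    have "z \<in> {a..a + L}" if "\<bar>x - z\<bar> < L / 4" for z
    proof -
      from that have "x - z < L / 4" "z - x < L / 4" by linarith+
      then show ?thesis using x by auto
    qed
    from this[OF close] have in_I: "h / q \<in> {a..a + L}" .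
    show "x \<in> U \<union> V"
    proof (cases "q \<le> M")
      case True
      have "h \<in> P q" using in_I q by (auto simp: P_def field_simps)
      moreover have "x \<in> B q h" using near unfolding B_def by auto
      ultimately show ?thesis using True q unfolding U_def by auto
    next
      case False
      then have "Q / 32 < q" using M(2) by linarith
      then have "Q / 32 * Q \<le> real q * Q" by (intro mult_right_mono) auto
      then have "1 / (real q * Q) \<le> 1 / (Q / 32 * Q)"
        using q Q0 by (intro divide_left_mono) auto
      also have "\<dots> = 32 / (real Q)\<^sup>2" by (simp add: power2_eq_square)
      finally have "x \<in> {h / q - 32 / (real Q)\<^sup>2 .. h / q + 32 / (real Q)\<^sup>2}"
        using near by auto
      moreover have "h / q \<in> ?R" using in_I q unfolding farey_def by auto
      ultimately show ?thesis unfolding V_def by blast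
    qed
  qed
  have Bm: "measure lborel (B q p) = 2 / (real q * Q)" for q p
    unfolding B_def using Q0 by (simp add: divide_nonneg_nonneg)
  have U1: "measure lborel (\<Union>p\<in>P q. B q p) \<le> 2 * L / Q + 2 / Q * (1 / q)" if "q \<in> {1..M}" for q
  proof -
    have "measure lborel (\<Union>p\<in>P q. B q p) \<le> (\<Sum>p\<in>P q. measure lborel (B q p))"
      using P by (intro measure_UNION_le) (auto simp: B_def)
    also have "\<dots> = card (P q) * (2 / (real q * Q))" by (simp add: Bm)
    also have "\<dots> \<le> (L * real q + 1) * (2 / (real q * Q))"
      using P by (intro mult_right_mono) auto
    also have "\<dots> = 2 * L / Q + 2 / Q * (1 / q)"
      using that Q0 by (simp add: field_simps)
    finally show ?thesis .
  qed
  have Ub: "measure lborel U \<le> L / 8"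
  proof -
    have "measure lborel U \<le> (\<Sum>q\<in>{1..M}. measure lborel (\<Union>p\<in>P q. B q p))"
      unfolding U_def using P by (intro measure_UNION_le) (auto simp: B_def)
    also have "\<dots> \<le> (\<Sum>q\<in>{1..M}. 2 * L / Q + 2 / Q * (1 / q))"
      by (intro sum_mono U1)
    also have "\<dots> = M * (2 * L / Q) + 2 / Q * (\<Sum>q=1..M. 1 / real q)"
      by (simp add: sum.distrib sum_distrib_left)
    \<comment> \<open>The first term is \<open>L / 16\<close>; the second is
      \<open>4 / sqrt Q\<close>, at most \<open>L / 16\<close> by the hypothesis on
      \<open>Q\<close>.\<close>
    also have "\<dots> \<le> (Q / 32) * (2 * L / Q) + 2 / Q * (2 * sqrt Q)"
    proof (intro add_mono mult_mono M order_refl)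
      have "real M \<le> Q" using M(1) by simp
      then have "sqrt M \<le> sqrt Q" by simp
      then show "(\<Sum>q=1..M. 1 / real q) \<le> 2 * sqrt Q" using sum_inverse_le_sqrt[of M] by linarith
    qed (use L in \<open>auto intro!: sum_nonneg\<close>)
    also have "2 / real Q * (2 * sqrt Q) = 4 / sqrt Q"
      using Q0 by (simp add: field_simps)
    also have "4 / sqrt Q \<le> L / 16" using Q Q0 by (simp add: field_simps)
    finally show ?thesis using Q0 by simp
  qed
  have Vb: "measure lborel V \<le> card ?R * (64 / (real Q)\<^sup>2)"
  proof -
    have "measure lborel V \<le> (\<Sum>r\<in>?R. measure lborel {r - 32 / (real Q)\<^sup>2 .. r + 32 / (real Q)\<^sup>2})"
      unfolding V_def using fin by (intro measure_UNION_le) auto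
    also have "\<dots> = card ?R * (64 / (real Q)\<^sup>2)" by simp
    finally show ?thesis .
  qed
  have UVf: "U \<in> fmeasurable lborel" "V \<in> fmeasurable lborel"
    unfolding U_def V_def using P fin by (auto simp: B_def intro!: fmeasurable.finite_UN interval_fmeasurable)
  \<comment> \<open>More than \<open>L / 4\<close> of the middle half is left to \<open>V\<close>,
    whose pieces have length \<open>64 / Q^2\<close>; hence the constant \<open>256\<close>.\<close>
  have "L / 2 = measure lborel {a + L/4..a + 3*L/4}" using L by simp
  also have "\<dots> \<le> measure lborel (U \<union> V)"
    by (intro measure_mono_fmeasurable cover) (use UVf in auto)
  also have "\<dots> \<le> measure lborel U + measure lborel V"
    by (intro measure_Un_le) (use UVf in auto)
  finally have "L / 4 \<le> card ?R * (64 / (real Q)\<^sup>2)" using Ub Vb L by linarith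
  then show "L * (real Q)\<^sup>2 / 256 \<le> card ?R"
    using Q0 by (simp add: field_simps)
qed

subsection \<open>Hausdorff measure\<close>

lemma diam_weight_nonempty:
  "U \<noteq> {} \<Longrightarrow> s > 0 \<Longrightarrow> diam_weight s U = ennreal (diameter U powr s)"
  by (simp add: diam_weight_def)

lemma diam_weight_empty [simp]: "diam_weight s {} = 0" by (simp add: diam_weight_def)

lemma hausdorff_premeasure_cover:
  assumes "A \<subseteq> (\<Union>i. U i)" "\<And>i. bounded (U i)" "\<And>i. diameter (U i) \<le> \<delta>"
  shows "hausdorff_premeasure s \<delta> A \<le> (\<Sum>i. diam_weight s (U i))"
  unfolding hausdorff_premeasure_def using assms by (intro INF_lower) auto

lemma hausdorff_premeasure_mono: "A \<subseteq> B \<Longrightarrow> hausdorff_premeasure s \<delta> A \<le> hausdorff_premeasure s \<delta> B"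
  unfolding hausdorff_premeasure_def by (intro INF_superset_mono) auto

lemma hausdorff_premeasure_single:
  assumes "bounded U" "diameter U \<le> \<delta>" "0 \<le> \<delta>"
  shows "hausdorff_premeasure s \<delta> U \<le> diam_weight s U"
proof -
  let ?U = "\<lambda>i::nat. if i = 0 then U else {}"
  have "hausdorff_premeasure s \<delta> U \<le> (\<Sum>i. diam_weight s (?U i))"
    using assms by (intro hausdorff_premeasure_cover) auto
  also have "\<dots> = (\<Sum>i\<in>{0}. diam_weight s (?U i))" by (rule suminf_finite) auto
  finally show ?thesis by simp
qed

lemma hausdorff_premeasure_lessE:
  assumes "hausdorff_premeasure s \<delta> A < c"
  obtains U where "A \<subseteq> (\<Union>i::nat. U i)" "\<And>i. bounded (U i)" "\<And>i. diameter (U i) \<le> \<delta>"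
    "(\<Sum>i. diam_weight s (U i)) < c"
  using assms unfolding hausdorff_premeasure_def INF_less_iff by auto

text \<open>Each \<open>A i\<close> gets a cover that is optimal up to
  \<open>e / 2 ^ (i + 1)\<close>; \<open>prod_decode\<close> lists the double family of covering
  sets as one sequence.\<close>

lemma hausdorff_premeasure_UN_le:
  "hausdorff_premeasure s \<delta> (\<Union>i::nat. A i) \<le> (\<Sum>i. hausdorff_premeasure s \<delta> (A i))"
proof (rule ennreal_le_epsilon)
  fix e :: real
  assume fin: "(\<Sum>i. hausdorff_premeasure s \<delta> (A i)) < top" and e: "0 < e"
  define d where "d i = e * (1/2) ^ Suc i" for i
  have d: "d i > 0" for i using e by (simp add: d_def)
  have fin1: "hausdorff_premeasure s \<delta> (A i) < top" for i
    using ennreal_suminf_lessD[OF fin, of i] .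
  have "\<exists>U. A i \<subseteq> (\<Union>j::nat. U j) \<and> (\<forall>j. bounded (U j) \<and> diameter (U j) \<le> \<delta>) \<and>
      (\<Sum>j. diam_weight s (U j)) \<le> hausdorff_premeasure s \<delta> (A i) + ennreal (d i)" for i
  proof -
    have "hausdorff_premeasure s \<delta> (A i) < hausdorff_premeasure s \<delta> (A i) + ennreal (d i)"
      using fin1[of i] d[of i] by (cases "hausdorff_premeasure s \<delta> (A i)")
        (auto simp: ennreal_plus[symmetric] ennreal_less_iff simp del: ennreal_plus)
    then show ?thesis by (elim hausdorff_premeasure_lessE) (meson less_imp_le)
  qed
  then obtain U where U: "\<And>i. A i \<subseteq> (\<Union>j::nat. U i j)" "\<And>i j. bounded (U i j)" "\<And>i j. diameter (U i j) \<le> \<delta>"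
     "\<And>i. (\<Sum>j. diam_weight s (U i j)) \<le> hausdorff_premeasure s \<delta> (A i) + ennreal (d i)"
    by metis
  let ?V = "\<lambda>n. case prod_decode n of (i, j) \<Rightarrow> U i j"
  have "hausdorff_premeasure s \<delta> (\<Union>i. A i) \<le> (\<Sum>n. diam_weight s (?V n))"
  proof (rule hausdorff_premeasure_cover)
    show "(\<Union>i. A i) \<subseteq> (\<Union>n. ?V n)"
    proof
      fix x assume "x \<in> (\<Union>i. A i)"
      then obtain i j where "x \<in> U i j" using U(1) by blast
      then have "x \<in> ?V (prod_encode (i, j))" by simp
      then show "x \<in> (\<Union>n. ?V n)" by (rule UN_I[OF UNIV_I])
    qed
    show "bounded (?V n)" "diameter (?V n) \<le> \<delta>" for n
      using U(2,3) by (simp_all split: prod.split)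
  qed
  also have "\<dots> = (\<Sum>n. (\<lambda>(i, j). diam_weight s (U i j)) (prod_decode n))"
    by (intro suminf_cong) (auto split: prod.split)
  also have "\<dots> = (\<Sum>i. \<Sum>j. diam_weight s (U i j))"
    by (rule suminf_ennreal_2dimen) auto
  also have "\<dots> \<le> (\<Sum>i. hausdorff_premeasure s \<delta> (A i) + ennreal (d i))"
    using U(4) by (intro suminf_le) auto
  also have "\<dots> = (\<Sum>i. hausdorff_premeasure s \<delta> (A i)) + (\<Sum>i. ennreal (d i))"
    by (rule suminf_add[symmetric]) auto
  also have "(\<Sum>i. ennreal (d i)) = ennreal e"
  proof -
    have "d sums (e * 1)" unfolding d_def by (intro sums_mult power_half_series)
    then show ?thesis using d by (intro suminf_ennreal_eq) (auto intro: less_imp_le)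
  qed
  finally show "hausdorff_premeasure s \<delta> (\<Union>i. A i) \<le> (\<Sum>i. hausdorff_premeasure s \<delta> (A i)) + ennreal e" .
qed

text \<open>Padding with empty sets reduces this to the countable case;
  \<open>0 \<le> \<delta>\<close> makes the empty set an admissible covering set.\<close>

lemma hausdorff_premeasure_finite_UN_le:
  fixes A :: "'a \<Rightarrow> 'b::metric_space set"
  assumes "finite I" "0 \<le> \<delta>"
  shows "hausdorff_premeasure s \<delta> (\<Union>i\<in>I. A i) \<le> (\<Sum>i\<in>I. hausdorff_premeasure s \<delta> (A i))"
proof -
  obtain h where h: "bij_betw h {0..<card I} I" using ex_bij_betw_nat_finite[OF assms(1)] by blast
  let ?B = "\<lambda>k. if k \<in> {0..<card I} then A (h k) else {}"
  have empty: "hausdorff_premeasure s \<delta> ({} :: 'b set) = 0"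
    using hausdorff_premeasure_single[of "{} :: 'b set" \<delta> s] assms by simp
  have "A ` I = (\<lambda>k. A (h k)) ` {0..<card I}"
    using bij_betw_imp_surj_on[OF h] by (metis image_image)
  then have "(\<Union>i\<in>I. A i) = (\<Union>k\<in>{0..<card I}. A (h k))" by simp
  also have "\<dots> = (\<Union>k. ?B k)" by (auto split: if_splits)
  finally have "(\<Union>i\<in>I. A i) = (\<Union>k. ?B k)" .
  then have "hausdorff_premeasure s \<delta> (\<Union>i\<in>I. A i) \<le> (\<Sum>k. hausdorff_premeasure s \<delta> (?B k))"
    using hausdorff_premeasure_UN_le[of s \<delta> ?B] by simp
  also have "\<dots> = (\<Sum>k\<in>{0..<card I}. hausdorff_premeasure s \<delta> (?B k))"
    by (rule suminf_finite) (auto simp: empty)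
  also have "\<dots> = (\<Sum>k\<in>{0..<card I}. hausdorff_premeasure s \<delta> (A (h k)))" by simp
  also have "\<dots> = (\<Sum>i\<in>I. hausdorff_premeasure s \<delta> (A i))"
    by (rule sum.reindex_bij_betw[OF h])
  finally show ?thesis .
qed

text \<open>Nullity can be handled one scale at a time: the upper bound treats each
  \<open>\<delta>\<close> separately, and the lower bounds use only the scale
  \<open>1\<close>.\<close>

lemma hausdorff_measure_eq_0_iff:
  "hausdorff_measure s A = 0 \<longleftrightarrow> (\<forall>\<delta>>0. hausdorff_premeasure s \<delta> A = 0)"
  unfolding hausdorff_measure_def bot_ennreal[symmetric] SUP_bot_conv by auto

lemma hausdorff_measure_null_UN:
  assumes "\<And>i::nat. hausdorff_measure s (A i) = 0" shows "hausdorff_measure s (\<Union>i. A i) = 0"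
  unfolding hausdorff_measure_eq_0_iff
proof (intro allI impI)
  fix \<delta> :: real assume "\<delta> > 0"
  then have "hausdorff_premeasure s \<delta> (A i) = 0" for i
    using assms unfolding hausdorff_measure_eq_0_iff by blast
  then show "hausdorff_premeasure s \<delta> (\<Union>i. A i) = 0"
    using hausdorff_premeasure_UN_le[of s \<delta> A] by simp
qed

lemma hausdorff_dim_le: "0 \<le> s \<Longrightarrow> hausdorff_measure s A = 0 \<Longrightarrow> hausdorff_dim A \<le> ereal s"
  unfolding hausdorff_dim_def by (rule Inf_lower) auto

lemma hausdorff_dim_ge:
  "(\<And>s. 0 \<le> s \<Longrightarrow> hausdorff_measure s A = 0 \<Longrightarrow> c \<le> ereal s) \<Longrightarrow> c \<le> hausdorff_dim A"
  unfolding hausdorff_dim_def by (rule Inf_greatest) auto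

subsection \<open>A Cantor set of well approximable numbers\<close>

text \<open>The first condition lets \<open>farey_count\<close> act on intervals of length
  \<open>L / 2\<close> with \<open>L = Q k powr (-lam)\<close>. The second bounds the loss factor
  \<open>512 / L\<close> by a power of the next denominator whose exponent tends to zero, so that
  one sequence serves all \<open>s < 2 / lam\<close>.\<close>

lemma ex_fast_sequence:
  fixes lam :: real assumes "lam \<ge> 2"
  shows "\<exists>Q :: nat \<Rightarrow> nat. Q 0 = 1 \<and> (\<forall>k. Q k \<ge> 1) \<and>
    (\<forall>k. 64 \<le> real (Q k) powr (-lam) / 2 * sqrt (Q (Suc k)) \<and>
         512 / real (Q k) powr (-lam) \<le> real (Q (Suc k)) powr (1 / (k + 1)))"
proof -
  let ?P = "\<lambda>n x :: nat. x \<ge> 1 \<and> (n = 0 \<longrightarrow> x = 1)"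
  let ?R = "\<lambda>k x y :: nat. 64 \<le> real x powr (-lam) / 2 * sqrt y \<and> 512 / real x powr (-lam) \<le> real y powr (1 / (real k + 1))"
  have "\<exists>Q. \<forall>n. ?P n (Q n) \<and> ?R n (Q n) (Q (Suc n))"
  proof (rule dependent_nat_choice)
    show "\<exists>x. ?P 0 x" by auto
    fix x n :: nat assume x: "?P n x"
    define t where "t = real x powr (-lam)"
    have t: "t > 0" using x by (simp add: t_def)
    have "filterlim (\<lambda>y::nat. t / 2 * sqrt y) at_top at_top"
      using t by real_asymp
    moreover have "filterlim (\<lambda>y::nat. real y powr (1 / (real n + 1))) at_top at_top"
      by (intro filterlim_compose[OF real_powr_at_top filterlim_real_sequentially]) auto
    ultimately have "eventually (\<lambda>y. 64 \<le> t / 2 * sqrt (real y)) at_top"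
       "eventually (\<lambda>y::nat. 512 / t \<le> real y powr (1 / (real n + 1))) at_top"
      unfolding filterlim_at_top by blast+
    with eventually_ge_at_top[of "1::nat"]
    have "eventually (\<lambda>y. y \<ge> 1 \<and> 64 \<le> t / 2 * sqrt (real y) \<and> 512 / t \<le> real y powr (1 / (real n + 1))) at_top"
      by eventually_elim auto
    then show "\<exists>y. ?P (Suc n) y \<and> ?R n x y"
      unfolding t_def by (auto dest!: eventually_happens)
  qed
  then obtain Q where "\<forall>n. ?P n (Q n) \<and> ?R n (Q n) (Q (Suc n))" by blast
  then show ?thesis by (intro exI[of _ Q]) (auto simp: add.commute)
qed

text \<open>The Cantor set: \<open>L k\<close> is the length of the level-\<open>k\<close> intervals, \<open>N k\<close> the number of children of each
  of them and \<open>P k\<close> their total number. The left endpoints \<open>g k m\<close> are rationals of denominator at most \<open>Q k\<close>,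
  numbered by \<open>m < P k\<close> such that the parent of \<open>m\<close> has number \<open>m div N (k - 1)\<close>. Hence \<open>X\<close>, which
  reads \<open>u \<in> [0,1)\<close> in the mixed radix system \<open>N\<close>, carries Lebesgue measure to the uniform measure of the Cantor set.\<close>

locale farey_cantor =
  fixes lam :: real and Q :: "nat \<Rightarrow> nat"
  assumes lam: "lam \<ge> 2" and Q0: "Q 0 = 1" and Q1: "\<And>k. Q k \<ge> 1"
    and big: "\<And>k. 64 \<le> real (Q k) powr (-lam) / 2 * sqrt (Q (Suc k))"
    and fast: "\<And>k. 512 / real (Q k) powr (-lam) \<le> real (Q (Suc k)) powr (1 / (k + 1))"
begin

definition L :: "nat \<Rightarrow> real" where "L k = real (Q k) powr (-lam)"
definition N :: "nat \<Rightarrow> nat" where "N k = nat \<lceil>L k * (real (Q (Suc k)))\<^sup>2 / 512\<rceil>"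
definition P :: "nat \<Rightarrow> nat" where "P k = (\<Prod>j<k. N j)"

lemma L0: "L 0 = 1" by (simp add: L_def Q0)
lemma Lpos: "L k > 0" using Q1[of k] by (simp add: L_def)
lemma L_le_1: "L k \<le> 1" using Q1[of k] lam powr_mono[of "-lam" 0 "real (Q k)"] by (simp add: L_def)

text \<open>By \<open>lam \<ge> 2\<close>. Distinct fractions of denominator at most
  \<open>Q k\<close> are therefore at least \<open>L k\<close> apart, and the intervals of one level
  overlap at most in end points.\<close>

lemma L_le_inverse_square: "L k \<le> 1 / (real (Q k))\<^sup>2"
proof -
  have "L k \<le> real (Q k) powr (-2)" unfolding L_def using Q1[of k] lam by (intro powr_mono) auto
  then show ?thesis using Q1[of k] by (simp add: powr_minus powr_numeral field_simps)
qed

lemma L_Suc: "L (Suc k) \<le> L k / 2"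
proof -
  let ?q = "real (Q (Suc k))"
  have q: "?q \<ge> 1" using Q1[of "Suc k"] by simp
  have "L (Suc k) \<le> ?q powr (-(1/2))" unfolding L_def using q lam by (intro powr_mono) auto
  also have "\<dots> = 1 / sqrt ?q" using q by (simp add: powr_minus powr_half_sqrt field_simps)
  also have "\<dots> \<le> L k / 2" using big[of k] q Lpos[of k] unfolding L_def[symmetric]
    by (simp add: field_simps)
  finally show ?thesis .
qed

lemma L_le_power: "L k \<le> (1/2) ^ k"
proof (induction k)
  case (Suc k) then show ?case using L_Suc[of k] by simp
qed (simp add: L0)

lemma L_tendsto_0: "L \<longlonglongrightarrow> 0"
  by (rule tendsto_sandwich[OF _ _ tendsto_const LIMSEQ_power_zero[of "1/2::real"]])
     (auto simp: L_le_power less_imp_le[OF Lpos])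

lemma N_ge: "L k * (real (Q (Suc k)))\<^sup>2 / 512 \<le> N k"
  unfolding N_def by linarith

lemma N_pos: "N k > 0"
proof -
  have "0 < L k * (real (Q (Suc k)))\<^sup>2 / 512"
    using Lpos[of k] Q1[of "Suc k"] by (intro divide_pos_pos mult_pos_pos) auto
  then show ?thesis using N_ge[of k] by linarith
qed

lemma P_pos: "P k > 0" unfolding P_def using N_pos by (intro prod_pos) auto
lemma P_Suc: "P (Suc k) = P k * N k" by (simp add: P_def)

text \<open>A child starts in the left half of its parent interval, so that by \<open>L_Suc\<close>
  its own interval stays inside. The constant \<open>1 / 256\<close> of \<open>farey_count\<close>,
  applied to length \<open>L k / 2\<close>, gives the \<open>512\<close> in
  \<open>N\<close>.\<close>

lemma ex_children:
  "\<exists>e. inj_on e {..<N k} \<and> e ` {..<N k} \<subseteq> farey (Q (Suc k)) \<inter> {a..a + L k / 2}"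
proof -
  have *: "64 \<le> L k / 2 * sqrt (Q (Suc k))" using big[of k] by (simp add: L_def)
  note c = farey_count[OF _ *, of a]
  have "N k \<le> card (farey (Q (Suc k)) \<inter> {a..a + L k / 2})"
    unfolding N_def using c(2) Lpos[of k] by (simp add: ceiling_le_iff)
  then have "\<exists>e. e ` {..<N k} \<subseteq> farey (Q (Suc k)) \<inter> {a..a + L k / 2} \<and> inj_on e {..<N k}"
    using c(1) Lpos[of k] by (intro card_le_inj) auto
  then show ?thesis by blast
qed

definition ch :: "nat \<Rightarrow> real \<Rightarrow> nat \<Rightarrow> real" where
  "ch k a = (SOME e. inj_on e {..<N k} \<and> e ` {..<N k} \<subseteq> farey (Q (Suc k)) \<inter> {a..a + L k / 2})"

lemma ch: "inj_on (ch k a) {..<N k}" "j < N k \<Longrightarrow> ch k a j \<in> farey (Q (Suc k))"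
    "j < N k \<Longrightarrow> a \<le> ch k a j" "j < N k \<Longrightarrow> ch k a j \<le> a + L k / 2"
  using someI_ex[OF ex_children[of k a]] unfolding ch_def[symmetric] by auto

primrec g :: "nat \<Rightarrow> nat \<Rightarrow> real" where
  "g 0 m = 0"
| "g (Suc k) m = ch k (g k (m div N k)) (m mod N k)"

lemma g_farey: "g k m \<in> farey (Q k)"
proof (cases k)
  case 0 have "0 = real_of_int 0 / real 1 \<and> 1 \<le> (1::nat) \<and> 1 \<le> Q k" using Q1 by simp
  then show ?thesis unfolding farey_def 0 g.simps by blast
next
  case (Suc j) then show ?thesis using N_pos[of j] by (auto intro!: ch)
qed

lemma g_bounds: "g k (m div N k) \<le> g (Suc k) m" "g (Suc k) m \<le> g k (m div N k) + L k / 2"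
  using N_pos[of k] by (auto intro!: ch)

text \<open>Distinct parents are at least \<open>L k\<close> apart, while a child is at most
  \<open>L k / 2\<close> to the right of its parent; so equal children have the same parent.\<close>

lemma g_inj: "inj_on (g k) {..<P k}"
proof (induction k)
  case (Suc k)
  show ?case
  proof (rule inj_onI)
    fix m m' assume m: "m \<in> {..<P (Suc k)}" "m' \<in> {..<P (Suc k)}" "g (Suc k) m = g (Suc k) m'"
    have par: "m div N k = m' div N k"
    proof (rule ccontr)
      assume ne: "m div N k \<noteq> m' div N k"
      have "m div N k < P k" "m' div N k < P k"
        using m N_pos[of k] by (auto simp: P_Suc less_mult_imp_div_less)
      then have "g k (m div N k) \<noteq> g k (m' div N k)" using ne inj_onD[OF Suc] by auto
      then have "L k \<le> \<bar>g k (m div N k) - g k (m' div N k)\<bar>"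
        using farey_separated[OF g_farey g_farey] L_le_inverse_square[of k] by (meson order_trans)
      then show False using m(3) g_bounds[of k m] g_bounds[of k m'] Lpos[of k] by linarith
    qed
    moreover from m(3) par have "m mod N k = m' mod N k"
      using inj_onD[OF ch(1)[of k]] N_pos[of k] by auto
    ultimately show "m = m'" by (metis div_mult_mod_eq)
  qed
qed (simp add: P_def lessThan_Suc)

section \<open>Mixed radix parametrisation of the Cantor set\<close>

definition idx :: "nat \<Rightarrow> real \<Rightarrow> nat" where "idx k u = nat \<lfloor>u * P k\<rfloor>"

lemma idx_less: "0 \<le> u \<Longrightarrow> u < 1 \<Longrightarrow> idx k u < P k"
  using P_pos[of k] unfolding idx_def by (simp add: nat_less_iff floor_less_iff)

lemma idx_Suc: "0 \<le> u \<Longrightarrow> idx (Suc k) u div N k = idx k u"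
proof -
  assume u: "0 \<le> u"
  have "u * P k = u * P (Suc k) / real_of_int (int (N k))"
    using N_pos[of k] by (simp add: P_Suc)
  then have "\<lfloor>u * P k\<rfloor> = \<lfloor>u * P (Suc k)\<rfloor> div int (N k)"
    by (metis floor_divide_real_eq_div of_nat_0_le_iff)
  then show ?thesis unfolding idx_def using u by (simp add: nat_div_distrib)
qed

definition Y :: "nat \<Rightarrow> real \<Rightarrow> real" where "Y k u = g k (idx k u)"

text \<open>The intervals \<open>[Y k u, Y k u + L k]\<close> are nested: the child moves right by
  at most \<open>L k / 2\<close> and has length at most \<open>L k / 2\<close>.\<close>

lemma Y_Suc: "0 \<le> u \<Longrightarrow> Y k u \<le> Y (Suc k) u" "0 \<le> u \<Longrightarrow> Y (Suc k) u + L (Suc k) \<le> Y k u + L k"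
  using g_bounds[of k "idx (Suc k) u"] L_Suc[of k] unfolding Y_def by (auto simp: idx_Suc)

lemma Y_mono: assumes "0 \<le> u" "j \<le> k" shows "Y j u \<le> Y k u" "Y k u + L k \<le> Y j u + L j"
  using assms(2) by (induction k rule: dec_induct; use Y_Suc[OF assms(1)] order_trans in blast)+

lemma Y_convergent: assumes "0 \<le> u" shows "convergent (\<lambda>k. Y k u)"
proof (rule Bseq_monoseq_convergent)
  have "\<bar>Y k u\<bar> \<le> 1" for k
    using Y_mono[OF assms, of 0 k] Lpos[of k] by (auto simp: Y_def L0)
  then show "Bseq (\<lambda>k. Y k u)" by (intro BseqI'[of _ 1]) auto
  show "monoseq (\<lambda>k. Y k u)" using Y_Suc[OF assms] by (intro mono_SucI1) auto
qed

definition X :: "real \<Rightarrow> real" where "X u = lim (\<lambda>k. Y k u)"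

lemma X_bounds: assumes "0 \<le> u" shows "Y k u \<le> X u" "X u \<le> Y k u + L k"
proof -
  have lim: "(\<lambda>j. Y j u) \<longlonglongrightarrow> X u"
    using Y_convergent[OF assms] unfolding X_def by (simp add: convergent_LIMSEQ_iff)
  show "Y k u \<le> X u"
    by (rule LIMSEQ_le_const[OF lim]) (use Y_mono[OF assms] in blast)
  have "Y j u \<le> Y k u + L k" if "j \<ge> k" for j
    using Y_mono(2)[OF assms that] Lpos[of j] by linarith
  then show "X u \<le> Y k u + L k"
    by (intro LIMSEQ_le_const2[OF lim]) blast
qed

lemma X_measurable [measurable]: "X \<in> borel_measurable borel"
proof -
  have "Y k \<in> borel_measurable borel" for k
    unfolding Y_def idx_def by measurable
  then show ?thesis unfolding X_def by (rule borel_measurable_lim_metric)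
qed

section \<open>Mass estimates for the Cantor measure\<close>

abbreviation mass :: "real set \<Rightarrow> real" where
  "mass A \<equiv> measure lborel {u \<in> {0..<1}. X u \<in> A}"

lemma mass_mono: "A \<subseteq> B \<Longrightarrow> A \<in> sets borel \<Longrightarrow> B \<in> sets borel \<Longrightarrow> mass A \<le> mass B"
proof (rule measure_mono_fmeasurable)
  assume B: "B \<in> sets borel"
  show "{u \<in> {0..<1}. X u \<in> B} \<in> fmeasurable lborel"
    by (rule fmeasurableI2[of "{0..<1}"]) (use B in \<open>auto intro!: interval_fmeasurable\<close>)
qed auto

lemma mass_le_1: "mass A \<le> 1"
proof (cases "{u \<in> {0..<1}. X u \<in> A} \<in> sets borel")
  case True
  have "mass A \<le> measure lborel {0..<1::real}"
    by (rule measure_mono_fmeasurable) (use True in \<open>auto intro!: interval_fmeasurable\<close>)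
  then show ?thesis by simp
qed (simp add: measure_notin_sets)

text \<open>If \<open>X u\<close> lies in \<open>[x, x + l]\<close>, then the left end
  \<open>Y k u\<close> lies in \<open>[x - L k, x + l]\<close>. By separation few left ends do, and
  each of them carries mass \<open>1 / P k\<close>.\<close>

lemma mass_count:
  assumes "0 \<le> l"
  shows "mass {x..x + l} \<le> ((l + L k) * (real (Q k))\<^sup>2 + 1) / P k"
proof -
  let ?S = "{m \<in> {..<P k}. g k m \<in> {x - L k .. x - L k + (l + L k)}}"
  have card: "real (card ?S) \<le> (l + L k) * (real (Q k))\<^sup>2 + 1"
  proof -
    have "card ?S = card (g k ` ?S)"
      by (rule card_image[symmetric]) (rule inj_on_subset[OF g_inj], auto)
    also have "real \<dots> \<le> (l + L k) / (1 / (real (Q k))\<^sup>2) + 1"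
      by (rule separated_card_le(2)[where x="x - L k"])
         (use assms Lpos[of k] Q1[of k] farey_separated[OF g_farey g_farey] in auto)
    finally show ?thesis by simp
  qed
  let ?I = "\<lambda>m::nat. {real m / P k ..< (real m + 1) / P k}"
  have I: "measure lborel (?I m) = 1 / P k" for m
    using P_pos[of k] by (simp add: divide_right_mono diff_divide_distrib[symmetric])
  have sub: "{u \<in> {0..<1}. X u \<in> {x..x + l}} \<subseteq> (\<Union>m\<in>?S. ?I m)"
  proof clarify
    fix u :: real assume u: "u \<in> {0..<1}" "X u \<in> {x..x + l}"
    have "idx k u \<in> ?S"
      using u idx_less[of u k] X_bounds[of u k] by (auto simp: Y_def)
    moreover have "real (idx k u) \<le> u * P k" "u * P k < real (idx k u) + 1"
      using u unfolding idx_def by (auto simp: of_nat_nat)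
    then have "u \<in> ?I (idx k u)" using P_pos[of k] by (simp add: field_simps)
    ultimately show "u \<in> (\<Union>m\<in>?S. ?I m)" by blast
  qed
  have "mass {x..x + l} \<le> measure lborel (\<Union>m\<in>?S. ?I m)"
    by (rule measure_mono_fmeasurable[OF sub]) (auto intro!: fmeasurable.finite_UN interval_fmeasurable)
  also have "\<dots> \<le> (\<Sum>m\<in>?S. measure lborel (?I m))"
    by (rule measure_UNION_le) auto
  also have "\<dots> = card ?S * (1 / P k)" by (simp only: I) simp
  also have "\<dots> \<le> ((l + L k) * (real (Q k))\<^sup>2 + 1) * (1 / P k)"
    by (intro mult_right_mono card) auto
  finally show ?thesis by simp
qed

lemma ex_level:
  assumes "0 < l" "l < 1" obtains k where "L (Suc k) \<le> l" "l < L k"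
proof -
  have "eventually (\<lambda>k. L k < l) sequentially"
    using order_tendstoD(2)[OF L_tendsto_0] assms by auto
  then obtain k where "L k < l" by (auto dest!: eventually_happens)
  then have ex: "\<exists>k. L k \<le> l" by (auto intro: less_imp_le)
  define j where "j = (LEAST k. L k \<le> l)"
  have j: "L j \<le> l" unfolding j_def by (rule LeastI_ex[OF ex])
  then obtain i where i: "j = Suc i" using assms L0 by (cases j) auto
  then have "\<not> L i \<le> l" using not_less_Least[of i "\<lambda>k. L k \<le> l"] by (auto simp: j_def)
  with i j show ?thesis using that by auto
qed

text \<open>The size of \<open>N k\<close> and the condition \<open>fast\<close> give
  \<open>1 / P (k + 1) \<le> L (k + 1) powr s'\<close> with
  \<open>s' = (2 - 1 / (k + 1)) / lam\<close>. These exponents tend to \<open>2 / lam\<close>, and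
  \<open>K\<close> absorbs the finitely many early levels.\<close>

lemma P_bound:
  assumes s: "0 < s" "s < 2 / lam"
  obtains K where "K \<ge> 1" "\<And>k. 1 / P k \<le> K * L k powr s"
proof -
  have "(\<lambda>k. (2 - 1 / real (k + 1)) / lam) \<longlonglongrightarrow> (2 - 0) / lam"
    using lam by (intro tendsto_intros LIMSEQ_ignore_initial_segment[OF lim_1_over_n]) auto
  then have "eventually (\<lambda>k. s < (2 - 1 / real (k + 1)) / lam) sequentially"
    using s by (intro order_tendstoD(1)) auto
  then obtain k0 where k0: "\<And>k. k \<ge> k0 \<Longrightarrow> s < (2 - 1 / real (k + 1)) / lam"
    unfolding eventually_sequentially by blast
  define K where "K = 1 + (\<Sum>j\<le>k0. 1 / (P j * L j powr s))"
  have sum0: "0 \<le> (\<Sum>j\<le>k0. 1 / (P j * L j powr s))" by (intro sum_nonneg) auto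
  have late: "1 / P (Suc k) \<le> L (Suc k) powr s" if "k \<ge> k0" for k
  proof -
    let ?q = "real (Q (Suc k))"
    have q: "?q \<ge> 1" using Q1[of "Suc k"] by simp
    have "1 * (L k * ?q\<^sup>2 / 512) \<le> real (P k) * real (N k)"
      using P_pos[of k] N_ge[of k] Lpos[of k] by (intro mult_mono) auto
    moreover have "0 < L k * ?q\<^sup>2 / 512" "0 < real (P k) * real (N k)"
      using Lpos[of k] q P_pos[of k] N_pos[of k] by (auto intro!: mult_pos_pos divide_pos_pos)
    ultimately have "1 / P (Suc k) \<le> 1 / (L k * ?q\<^sup>2 / 512)"
      unfolding P_Suc of_nat_mult by (intro divide_left_mono) (auto intro!: mult_pos_pos)
    also have "\<dots> = 512 / L k * ?q powr (-2)" using q by (simp add: powr_minus powr_numeral field_simps)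
    also have "\<dots> \<le> ?q powr (1 / (k + 1)) * ?q powr (-2)"
      using fast[of k] unfolding L_def[symmetric] of_nat_add of_nat_1 by (intro mult_right_mono) (auto simp: add.commute)
    also have "\<dots> = L (Suc k) powr ((2 - 1 / real (k + 1)) / lam)"
      unfolding L_def using q lam by (simp add: powr_powr powr_add[symmetric])
    also have "\<dots> \<le> L (Suc k) powr s"
      using k0[OF that] Lpos[of "Suc k"] L_le_1[of "Suc k"] by (intro powr_mono') auto
    finally show ?thesis .
  qed
  have "1 / P k \<le> K * L k powr s" for k
  proof (cases "k \<le> k0")
    case True
    have "1 / (P k * L k powr s) \<le> (\<Sum>j\<le>k0. 1 / (P j * L j powr s))"
      using True by (intro member_le_sum) auto
    then have "1 / (P k * L k powr s) \<le> K" unfolding K_def by linarith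
    then show ?thesis using P_pos[of k] Lpos[of k] by (simp add: field_simps)
  next
    case False
    then obtain j where "k = Suc j" "j \<ge> k0" by (cases k) auto
    then have "1 / P k \<le> 1 * L k powr s" using late by simp
    also have "\<dots> \<le> K * L k powr s" using sum0 by (intro mult_right_mono) (auto simp: K_def)
    finally show ?thesis .
  qed
  then show ?thesis using that[of K] sum0 by (auto simp: K_def)
qed

text \<open>For \<open>l\<close> between \<open>L (k + 1)\<close> and \<open>L k\<close> the left
  ends of level \<open>k + 1\<close> are counted. If at most two are met, \<open>P_bound\<close> at
  level \<open>k + 1\<close> suffices. Otherwise their number is proportional to \<open>l\<close>,
  the mass is of order \<open>(1 / P k) * (l / L k)\<close>, and \<open>s < 1\<close> allows
  replacing \<open>l / L k\<close> by its power \<open>s\<close>.\<close>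

lemma mass_bound:
  assumes s: "0 < s" "s < 2 / lam"
  obtains C where "C \<ge> 0" "\<And>x l. 0 \<le> l \<Longrightarrow> mass {x..x + l} \<le> C * l powr s"
proof -
  obtain K where K: "K \<ge> 1" "\<And>k. 1 / P k \<le> K * L k powr s" using P_bound[OF s] by blast
  have "2 / lam \<le> 1" using lam by simp
  then have s1: "s < 1" using s by linarith
  have pos: "mass {x..x + l} \<le> 2048 * K * l powr s" if l: "0 < l" for x l
  proof (cases "l < 1")
    case False
    have "1 * 1 \<le> (2048 * K) * l powr s"
      using False K s by (intro mult_mono) (auto intro!: ge_one_powr_ge_zero)
    then show ?thesis using mass_le_1[of "{x..x+l}"] by linarith
  next
    case True
    obtain k where k: "L (Suc k) \<le> l" "l < L k" using ex_level[OF l True] .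
    let ?q = "real (Q (Suc k))" and ?P = "real (P (Suc k))"
    have P': "?P > 0" using P_pos by simp
    have "mass {x..x + l} \<le> ((l + L (Suc k)) * ?q\<^sup>2 + 1) / ?P"
      using mass_count l by simp
    also have "\<dots> \<le> (2 * l * ?q\<^sup>2 + 1) / ?P"
      using k P' by (intro divide_right_mono add_mono mult_right_mono) auto
    finally have m: "mass {x..x + l} \<le> (2 * l * ?q\<^sup>2 + 1) / ?P" .
    show ?thesis
    proof (cases "2 * l * ?q\<^sup>2 \<le> 1")
      case True
      have "(2 * l * ?q\<^sup>2 + 1) / ?P \<le> 2 * (1 / ?P)"
        using True P' by (simp add: divide_right_mono)
      also have "\<dots> \<le> 2 * (K * L (Suc k) powr s)" using K(2)[of "Suc k"] by linarith
      also have "\<dots> \<le> 2 * (K * l powr s)"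
        using k K Lpos[of "Suc k"] s by (intro mult_left_mono powr_mono2) auto
      also have "\<dots> \<le> 2048 * K * l powr s" using K by simp
      finally show ?thesis using m by linarith
    next
      case False
      have "(2 * l * ?q\<^sup>2 + 1) / ?P \<le> (4 * l * ?q\<^sup>2) / ?P"
        using False P' by (intro divide_right_mono) auto
      also have "\<dots> \<le> (4 * l * ?q\<^sup>2) / (P k * (L k * ?q\<^sup>2 / 512))"
        unfolding P_Suc of_nat_mult using N_ge[of k] P_pos[of k] N_pos[of k] Lpos[of k] Q1[of "Suc k"] l
        by (intro divide_left_mono mult_left_mono mult_pos_pos) auto
      also have "\<dots> = 2048 * (1 / P k) * (l / L k)"
        using Q1[of "Suc k"] Lpos[of k] P_pos[of k] by (simp add: field_simps)
      also have "\<dots> \<le> 2048 * (K * L k powr s) * (l / L k) powr s"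
      proof (intro mult_mono)
        have "(l / L k) powr 1 \<le> (l / L k) powr s"
          using k l s1 by (intro powr_mono') auto
        then show "l / L k \<le> (l / L k) powr s" using k l by simp
      qed (use K l k in auto)
      also have "\<dots> = 2048 * K * l powr s"
        using l Lpos[of k] by (simp add: powr_divide)
      finally show ?thesis using m by linarith
    qed
  qed
  \<comment> \<open>At \<open>l = 0\<close> the claimed bound is \<open>0\<close>, because
    \<open>0 powr s = 0\<close>; it follows by letting the length tend to zero.\<close>
  have zero: "mass {x..x} \<le> 0" for x
  proof (rule tendsto_lowerbound)
    show "((\<lambda>l. 2048 * K * l powr s) \<longlongrightarrow> 0) (at_right 0)"
    proof -
      have "((\<lambda>l::real. l powr s) \<longlongrightarrow> 0) (at_right 0)" using s by real_asymp
      then have "((\<lambda>l. (2048 * K) * l powr s) \<longlongrightarrow> (2048 * K) * 0) (at_right 0)" by (intro tendsto_intros)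
      then show ?thesis by simp
    qed
    have "mass {x..x} \<le> 2048 * K * l powr s" if "l > 0" for l
      using pos[OF that, of x] mass_mono[of "{x..x}" "{x..x+l}"] that by fastforce
    then show "eventually (\<lambda>l. mass {x..x} \<le> 2048 * K * l powr s) (at_right 0)"
      by (simp add: eventually_at_filter)
  qed simp
  have "mass {x..x + l} \<le> 2048 * K * l powr s" if "0 \<le> l" for x l
    using pos[of l x] zero[of x] that by (cases "l = 0") auto
  then show ?thesis using that[of "2048 * K"] K by auto
qed

end

text \<open>\<open>M\<close> is the image of Lebesgue measure on \<open>[0,1)\<close> under
  \<open>X\<close>. Approximations are asked for within every distance \<open>d\<close>, not in
  infinite number, since rational points are discarded only later.\<close>

lemma ex_jarnik_measure:
  fixes lam :: real assumes lam: "lam \<ge> 2"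
  obtains M :: "real measure" where "prob_space M" "sets M = sets borel"
    "\<And>s. 0 < s \<Longrightarrow> s < 2 / lam \<Longrightarrow> \<exists>C\<ge>0. \<forall>x l. 0 \<le> l \<longrightarrow> measure M {x..x + l} \<le> C * l powr s"
    "AE x in M. x \<in> {0..1}"
    "AE x in M. \<forall>d>0. \<exists>(p::int) (q::nat). q \<ge> 1 \<and> \<bar>x - p / q\<bar> \<le> d \<and> \<bar>x - p / q\<bar> \<le> real q powr (-lam)"
proof -
  obtain Q :: "nat \<Rightarrow> nat" where "farey_cantor lam Q"
    using ex_fast_sequence[OF lam] lam unfolding farey_cantor_def by blast
  then interpret farey_cantor lam Q .
  define R where "R = restrict_space lborel {0..<1::real}"
  define M where "M = distr R borel X"
  interpret R: prob_space R
    by (rule prob_spaceI) (auto simp: R_def space_restrict_space emeasure_restrict_space)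
  have Xm: "X \<in> measurable R borel" unfolding R_def
    by (rule measurable_restrict_space1) simp
  have spR: "space R = {0..<1}" by (simp add: R_def space_restrict_space)
  interpret M: prob_space M unfolding M_def by (rule R.prob_space_distr[OF Xm])
  have meas: "measure M A = mass A" if A: "A \<in> sets borel" for A
  proof -
    have "measure M A = measure R (X -` A \<inter> space R)" unfolding M_def
      using Xm A by (rule measure_distr)
    also have "\<dots> = measure lborel (X -` A \<inter> {0..<1})"
      unfolding R_def by (subst measure_restrict_space) (auto simp: space_restrict_space)
    also have "X -` A \<inter> {0..<1} = {u \<in> {0..<1}. X u \<in> A}" by auto
    finally show ?thesis .
  qed
  have AE: "AE x in M. Pr x" if "\<And>u. 0 \<le> u \<Longrightarrow> u < 1 \<Longrightarrow> Pr (X u)" "{x. Pr x} \<in> sets borel" for Pr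
  proof -
    have "AE x in R. Pr (X x)" using that by (intro AE_I2) (auto simp: spR)
    then show ?thesis unfolding M_def using that Xm by (subst AE_distr_iff) auto
  qed
  show ?thesis
  proof (rule that[of M])
    show "prob_space M" by (rule M.prob_space_axioms)
    show "sets M = sets borel" by (simp add: M_def)
    show "\<exists>C\<ge>0. \<forall>x l. 0 \<le> l \<longrightarrow> measure M {x..x + l} \<le> C * l powr s" if "0 < s" "s < 2 / lam" for s
      using mass_bound[OF that] by (metis meas atLeastAtMost_borel)
    show "AE x in M. x \<in> {0..1}"
    proof (rule AE)
      fix u :: real assume "0 \<le> u" "u < 1"
      then show "X u \<in> {0..1}" using X_bounds[of u 0] by (auto simp: Y_def L0)
    qed simp
    show "AE x in M. \<forall>d>0. \<exists>(p::int) (q::nat). q \<ge> 1 \<and> \<bar>x - p / q\<bar> \<le> d \<and> \<bar>x - p / q\<bar> \<le> real q powr (-lam)"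
    proof -
      \<comment> \<open>The countably many distances \<open>1 / Suc n\<close> keep the property
        measurable.\<close>
      have "AE x in M. \<forall>n::nat. \<exists>(p::int) (q::nat). q \<ge> 1 \<and> \<bar>x - p / q\<bar> \<le> 1 / Suc n \<and> \<bar>x - p / q\<bar> \<le> real q powr (-lam)"
      proof (rule AE)
        fix u :: real assume u: "0 \<le> u" "u < 1"
        show "\<forall>n::nat. \<exists>(p::int) (q::nat). q \<ge> 1 \<and> \<bar>X u - p / q\<bar> \<le> 1 / Suc n \<and> \<bar>X u - p / q\<bar> \<le> real q powr (-lam)"
        proof
          fix n :: nat
          have "eventually (\<lambda>k. L k < 1 / Suc n) sequentially"
            using order_tendstoD(2)[OF L_tendsto_0, of "1 / Suc n"] by simp
          then obtain k where k: "L k < 1 / Suc n" by (auto dest!: eventually_happens)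
          obtain p q where pq: "Y k u = real_of_int p / real q" "1 \<le> q" "q \<le> Q k"
            using g_farey[of k "idx k u"] unfolding farey_def Y_def by blast
          have "L k \<le> real q powr (-lam)"
            unfolding L_def using pq lam by (intro powr_mono2') auto
          moreover have "\<bar>X u - Y k u\<bar> \<le> L k" using X_bounds[OF u(1), of k] by auto
          ultimately show "\<exists>(p::int) (q::nat). q \<ge> 1 \<and> \<bar>X u - p / q\<bar> \<le> 1 / Suc n \<and> \<bar>X u - p / q\<bar> \<le> real q powr (-lam)"
            using pq k by (intro exI[of _ p] exI[of _ q]) auto
        qed
      qed measurable
      then show ?thesis
      proof eventually_elim
        fix x
        assume *: "\<forall>n::nat. \<exists>(p::int) (q::nat). q \<ge> 1 \<and> \<bar>x - p / q\<bar> \<le> 1 / Suc n \<and> \<bar>x - p / q\<bar> \<le> real q powr (-lam)"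
        show "\<forall>d>0. \<exists>(p::int) (q::nat). q \<ge> 1 \<and> \<bar>x - p / q\<bar> \<le> d \<and> \<bar>x - p / q\<bar> \<le> real q powr (-lam)"
        proof (intro allI impI)
          fix d :: real assume "d > 0"
          then obtain n where "1 / Suc n < d" using nat_approx_posE by metis
          then show "\<exists>(p::int) (q::nat). q \<ge> 1 \<and> \<bar>x - p / q\<bar> \<le> d \<and> \<bar>x - p / q\<bar> \<le> real q powr (-lam)"
            using *[rule_format, of n] by (meson less_imp_le order_trans)
        qed
      qed
    qed
  qed
qed

subsection \<open>The irrationality exponent\<close>

definition approximants :: "real \<Rightarrow> real \<Rightarrow> real set" where
  "approximants x m = {real_of_int p / real q | (p :: int) (q :: nat).
     q \<ge> 1 \<and> \<bar>x - real_of_int p / real q\<bar> \<le> real q powr (- m)}"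

lemma irrationality_exponent_eq:
  "irrationality_exponent x = Sup (ereal ` {m. infinite (approximants x m)})"
  unfolding irrationality_exponent_def approximants_def ..

lemma approximants_antimono: "m \<le> m' \<Longrightarrow> approximants x m' \<subseteq> approximants x m"
proof -
  assume m: "m \<le> m'"
  have "real q powr (-m') \<le> real q powr (-m)" if "q \<ge> 1" for q :: nat
    using that m by (intro powr_mono) auto
  then show ?thesis unfolding approximants_def by force
qed

lemma le_irrationality_exponent:
  "infinite (approximants x m) \<Longrightarrow> ereal m \<le> irrationality_exponent x"
  unfolding irrationality_exponent_eq by (rule Sup_upper) auto

lemma irrationality_exponent_le:
  assumes "\<And>m. m > b \<Longrightarrow> finite (approximants x m)"
  shows "irrationality_exponent x \<le> ereal b"
  unfolding irrationality_exponent_eq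
proof (rule Sup_least, clarify)
  fix m assume "infinite (approximants x m)"
  then show "ereal m \<le> ereal b" using assms[of m] by force
qed

lemma less_irrationality_exponent:
  assumes "ereal m < irrationality_exponent x" shows "infinite (approximants x m)"
proof -
  obtain m' where "m < m'" "infinite (approximants x m')"
    using assms unfolding irrationality_exponent_eq less_Sup_iff by auto
  then show ?thesis using approximants_antimono[of m m' x] infinite_super by auto
qed

text \<open>Fractions of bounded denominator are separated, and \<open>m \<ge> 0\<close> confines
  the approximants to distance \<open>1\<close> from \<open>x\<close>.\<close>

lemma finite_approximants:
  assumes m: "m \<ge> 0"
    and bd: "\<And>(p::int) (q::nat). q \<ge> 1 \<Longrightarrow> \<bar>x - p / q\<bar> \<le> real q powr (-m) \<Longrightarrow> q \<le> B"
  shows "finite (approximants x m)"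
proof (rule finite_subset)
  show "approximants x m \<subseteq> farey B \<inter> {x - 1..x - 1 + 2}"
  proof
    fix r assume "r \<in> approximants x m"
    then obtain p q where pq: "r = real_of_int p / real q" "q \<ge> 1" "\<bar>x - real_of_int p / real q\<bar> \<le> real q powr (- m)"
      unfolding approximants_def by blast
    have "real q powr (-m) \<le> real q powr 0" using pq m by (intro powr_mono) auto
    then have "\<bar>x - r\<bar> \<le> 1" using pq by simp
    then have "r \<in> {x - 1..x - 1 + 2}" by (auto simp: abs_le_iff)
    moreover have "r \<in> farey B" using pq bd unfolding farey_def by blast
    ultimately show "r \<in> farey B \<inter> {x - 1..x - 1 + 2}" by blast
  qed
  show "finite (farey B \<inter> {x - 1..x - 1 + 2})"
  proof (cases "B = 0")
    case False
    then show ?thesis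
      by (intro separated_card_le(1)[of _ "x - 1" 2 "1 / (real B)\<^sup>2"]) (auto intro: farey_separated)
  qed (auto simp: farey_def)
qed

text \<open>A finite set of approximants would have positive distance from the irrational
  \<open>x\<close>.\<close>

lemma infinite_approximants:
  assumes x: "x \<notin> \<rat>"
    and near: "\<And>d. d > 0 \<Longrightarrow> \<exists>(p::int) (q::nat). q \<ge> 1 \<and> \<bar>x - p / q\<bar> \<le> d \<and> \<bar>x - p / q\<bar> \<le> real q powr (-m)"
  shows "infinite (approximants x m)"
proof
  assume fin: "finite (approximants x m)"
  have "x \<notin> approximants x m" using x unfolding approximants_def by auto
  then obtain d where d: "d > 0" "\<And>r. r \<in> approximants x m \<Longrightarrow> d \<le> dist x r"
    using finite_set_avoid[OF fin, of x] by metis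
  obtain p :: int and q :: nat where pq: "q \<ge> 1" "\<bar>x - p / q\<bar> \<le> d / 2" "\<bar>x - p / q\<bar> \<le> real q powr (-m)"
    using near[of "d / 2"] d by auto
  then have "p / q \<in> approximants x m" unfolding approximants_def by blast
  from d(2)[OF this] pq(2) d(1) show False by (simp add: dist_real_def)
qed

text \<open>Single points have no mass, so the rationals are null. For \<open>m > lam\<close>
  Borel--Cantelli applies: about \<open>3 * q\<close> fractions of denominator \<open>q\<close>
  matter, each with a neighbourhood of mass at most of order \<open>q powr (- m * s)\<close>, and
  \<open>m * s > 2\<close> for \<open>s\<close> close to \<open>2 / lam\<close>.\<close>

lemma ex_exact_order_measure:
  fixes lam :: real assumes lam: "lam \<ge> 2"
  obtains M :: "real measure" where "prob_space M" "sets M = sets borel"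
    "\<And>s. 0 < s \<Longrightarrow> s < 2 / lam \<Longrightarrow> \<exists>C\<ge>0. \<forall>x l. 0 \<le> l \<longrightarrow> measure M {x..x + l} \<le> C * l powr s"
    "AE x in M. irrationality_exponent x = ereal lam"
proof -
  obtain M :: "real measure" where M: "prob_space M" "sets M = sets borel"
    "\<And>s. 0 < s \<Longrightarrow> s < 2 / lam \<Longrightarrow> \<exists>C\<ge>0. \<forall>x l. 0 \<le> l \<longrightarrow> measure M {x..x + l} \<le> C * l powr s"
    "AE x in M. x \<in> {0..1}"
    "AE x in M. \<forall>d>0. \<exists>(p::int) (q::nat). q \<ge> 1 \<and> \<bar>x - p / q\<bar> \<le> d \<and> \<bar>x - p / q\<bar> \<le> real q powr (-lam)"
    using ex_jarnik_measure[OF lam] by blast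
  interpret prob_space M by (rule M(1))
  have point: "{x} \<in> null_sets M" for x
  proof -
    obtain C where C: "\<forall>x l. 0 \<le> l \<longrightarrow> measure M {x..x + l} \<le> C * l powr (1 / lam)"
      using M(3)[of "1 / lam"] lam by (auto simp: field_simps)
    have "measure M {x..x + 0} \<le> C * 0 powr (1 / lam)" using C by blast
    then have "measure M {x} = 0" using measure_nonneg[of M "{x}"] by simp
    then show ?thesis using M(2) by (simp add: null_sets_def emeasure_eq_measure)
  qed
  have "(\<Union>x\<in>\<rat>. {x}) \<in> null_sets M"
    using point by (intro null_sets_UN') (auto simp: countable_rat)
  then have irr: "AE x in M. x \<notin> \<rat>" using AE_not_in by fastforce
  have upper: "AE x in M. finite (approximants x m)" if m: "m > lam" for m
  proof -
    \<comment> \<open>Below \<open>2 / lam\<close> the mass bound is available, above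
      \<open>2 / m\<close> the series converges; the midpoint satisfies both.\<close>
    define s where "s = (2 / m + 2 / lam) / 2"
    have "2 / m < 2 / lam" using m lam by (intro divide_strict_left_mono) auto
    then have s: "2 / m < s" "s < 2 / lam" "0 < s" using m lam by (auto simp: s_def intro!: add_pos_pos)
    then have ms: "2 < m * s" using m lam by (simp add: field_simps)
    obtain C where C: "C \<ge> 0" "\<forall>x l. 0 \<le> l \<longrightarrow> measure M {x..x + l} \<le> C * l powr s"
      using M(3)[OF s(3,2)] by blast
    define B where "B q p = {p / q - real q powr (-m) .. p / q + real q powr (-m)}" for q :: nat and p :: int
    \<comment> \<open>For \<open>x\<close> in \<open>[0,1]\<close> and radius at most
      \<open>1\<close> only these numerators occur.\<close>
    define A where "A q = (if q = 0 then {} else \<Union>p\<in>{-int q..2 * int q}. B q p)" for q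
    have A_sets: "A q \<in> sets M" for q
      unfolding A_def B_def M(2) by auto
    have A_bound: "measure M (A q) \<le> 4 * C * 2 powr s * real q powr (1 - m * s)" for q
    proof (cases "q = 0")
      case False
      have "measure M (A q) \<le> (\<Sum>p\<in>{-int q..2 * int q}. measure M (B q p))"
        unfolding A_def using False by (auto intro!: finite_measure_subadditive_finite simp: M(2) B_def)
      also have "\<dots> \<le> (\<Sum>p\<in>{-int q..2 * int q}. C * (2 * real q powr (-m)) powr s)"
      proof (rule sum_mono)
        fix p
        have "B q p = {p / q - real q powr (-m) .. (p / q - real q powr (-m)) + 2 * real q powr (-m)}"
          unfolding B_def by auto
        then show "measure M (B q p) \<le> C * (2 * real q powr (-m)) powr s"
          using C(2)[rule_format, of "2 * real q powr (-m)" "p / q - real q powr (-m)"] by simp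
      qed
      also have "\<dots> = (3 * real q + 1) * (C * (2 * real q powr (-m)) powr s)" by simp
      also have "\<dots> \<le> (4 * real q) * (C * (2 * real q powr (-m)) powr s)"
        using False C(1) by (intro mult_right_mono mult_nonneg_nonneg) auto
      also have "\<dots> = 4 * C * 2 powr s * (real q powr 1 * real q powr (- m * s))"
        using False by (simp add: powr_mult powr_powr)
      also have "real q powr 1 * real q powr (- m * s) = real q powr (1 - m * s)"
      proof -
        have "1 - m * s = 1 + (- m * s)" by simp
        then show ?thesis by (simp only: powr_add)
      qed
      finally show ?thesis .
    qed (simp add: A_def C)
    have "summable (\<lambda>q. 4 * C * 2 powr s * real q powr (1 - m * s))"
      using ms by (intro summable_mult) (simp add: summable_real_powr_iff)
    then have "summable (\<lambda>q. measure M (A q))"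
      by (rule summable_comparison_test_ev[rotated]) (use A_bound in auto)
    then have "AE x in M. eventually (\<lambda>q. x \<in> space M - A q) sequentially"
      by (intro borel_cantelli_AE1 A_sets) (auto simp: emeasure_eq_measure)
    with M(4) show ?thesis
    proof eventually_elim
      fix x assume x: "x \<in> {0..1}" and "eventually (\<lambda>q. x \<in> space M - A q) sequentially"
      then obtain b where b: "\<And>q. q \<ge> b \<Longrightarrow> x \<notin> A q" unfolding eventually_sequentially by blast
      show "finite (approximants x m)"
      proof (rule finite_approximants[where B=b])
        fix p :: int and q :: nat
        assume q: "q \<ge> 1" and le: "\<bar>x - p / q\<bar> \<le> real q powr (-m)"
        have "real q powr (-m) \<le> real q powr 0" using q m lam by (intro powr_mono) auto
        then have "\<bar>x - p / q\<bar> \<le> 1" using le q by simp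
        then have "-1 \<le> p / q" "p / q \<le> 2" using x by (auto simp: abs_le_iff)
        then have "p \<in> {-int q..2 * int q}" using q by (simp add: field_simps)
        moreover have "x \<in> B q p" using le by (auto simp: B_def abs_le_iff)
        ultimately have "x \<in> A q" using q by (auto simp: A_def)
        then show "q \<le> b" using b[of q] by force
      qed (use m lam in auto)
    qed
  qed
  \<comment> \<open>Monotonicity in \<open>m\<close> reduces all \<open>m > lam\<close> to this
    countable family.\<close>
  have "AE x in M. \<forall>n::nat. finite (approximants x (lam + 1 / Suc n))"
    unfolding AE_all_countable by (auto intro!: upper)
  with irr M(5) have exact: "AE x in M. irrationality_exponent x = ereal lam"
  proof eventually_elim
    fix x
    assume x: "x \<notin> \<rat>" "\<forall>d>0. \<exists>(p::int) (q::nat). q \<ge> 1 \<and> \<bar>x - p / q\<bar> \<le> d \<and> \<bar>x - p / q\<bar> \<le> real q powr (-lam)"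
      "\<forall>n::nat. finite (approximants x (lam + 1 / Suc n))"
    show "irrationality_exponent x = ereal lam"
    proof (rule antisym)
      show "ereal lam \<le> irrationality_exponent x"
        using x by (intro le_irrationality_exponent infinite_approximants) auto
      show "irrationality_exponent x \<le> ereal lam"
      proof (rule irrationality_exponent_le)
        fix m assume "m > lam"
        then obtain n where "1 / Suc n < m - lam" using nat_approx_posE[of "m - lam"] by auto
        then have "lam + 1 / Suc n \<le> m" by linarith
        from finite_subset[OF approximants_antimono[OF this]] x(3) show "finite (approximants x m)" by blast
      qed
    qed
  qed
  show ?thesis by (rule that[OF M(1,2,3) exact])
qed

subsection \<open>The upper bound\<close>

lemma diameter_le_coordinatewise:
  fixes S :: "(real ^ 'n) set"
  assumes c: "0 \<le> c" and S: "\<And>x y j. x \<in> S \<Longrightarrow> y \<in> S \<Longrightarrow> \<bar>x $ j - y $ j\<bar> \<le> c"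
  shows "bounded S" "diameter S \<le> real CARD('n) * c"
proof -
  have norm: "norm (x - y) \<le> real CARD('n) * c" if "x \<in> S" "y \<in> S" for x y
  proof -
    have "norm (x - y) \<le> (\<Sum>j\<in>UNIV. \<bar>(x - y) $ j\<bar>)" by (rule norm_le_l1_cart)
    also have "\<dots> \<le> (\<Sum>j\<in>(UNIV::'n set). c)" using S[OF that] by (intro sum_mono) simp
    finally show ?thesis by simp
  qed
  show "bounded S"
  proof (cases "S = {}")
    case False
    then obtain z where "z \<in> S" by blast
    then show ?thesis unfolding bounded_def dist_norm using norm by blast
  qed simp
  show "diameter S \<le> real CARD('n) * c" using c norm by (intro diameter_le) auto
qed

lemma diam_weight_le:
  assumes "s > 0" "diameter U \<le> c" "bounded U" shows "diam_weight s U \<le> ennreal (c powr s)"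
  using assms by (cases "U = {}")
    (auto simp: diam_weight_nonempty diameter_ge_0 intro!: ennreal_leI powr_mono2)

lemma infinite_approximants_large:
  assumes "infinite (approximants x m)" "m \<ge> 0"
  obtains p :: int and q :: nat where "q > B" "q \<ge> 1" "\<bar>x - p / q\<bar> \<le> real q powr (-m)"
proof -
  have "\<exists>(p::int) (q::nat). q > B \<and> q \<ge> 1 \<and> \<bar>x - p / q\<bar> \<le> real q powr (-m)"
  proof (rule ccontr)
    assume no: "\<not> ?thesis"
    have "finite (approximants x m)"
      by (rule finite_approximants[OF assms(2), where B=B]) (use no in force)
    with assms(1) show False by blast
  qed
  then show ?thesis using that by blast
qed

text \<open>With \<open>n\<close> the dimension, denominator \<open>q\<close> contributes about
  \<open>q\<close> slabs in a bounded region, each cut into about \<open>h powr (- (n - 1))\<close>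
  boxes of size \<open>h = q powr (-m)\<close>. Their weights add up to order
  \<open>q powr (1 + m * (n - 1) - m * s)\<close>, and the exponent is below \<open>-1\<close> since
  \<open>s > n - 1 + 2 / m\<close>.\<close>

lemma hausdorff_measure_well_approximable:
  fixes i :: "'n::finite" and m s :: real
  assumes m: "m > 0" and s: "real CARD('n) - 1 + 2 / m < s"
  shows "hausdorff_measure s {x :: real ^ 'n. infinite (approximants (x $ i) m)} = 0"
proof -
  define d where "d = CARD('n) - 1"
  define n where "n = real CARD('n)"
  have d: "real d = n - 1" unfolding d_def n_def using zero_less_card_finite[where 'a='n]
    by (simp add: of_nat_diff Suc_leI)
  have n1: "n \<ge> 1" unfolding n_def using zero_less_card_finite[where 'a='n] by linarith
  have s0: "s > 0" using s m n1 unfolding n_def by (smt (verit) divide_pos_pos)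
  define h where "h q = real q powr (-m)" for q :: nat
  have h: "0 < h q" "h q \<le> 1" if "q \<ge> 1" for q
    using that m powr_mono[of "-m" 0 "real q"] by (auto simp: h_def)
  \<comment> \<open>Truncation to bounded parts makes the number of boxes finite for each
    \<open>q\<close>.\<close>
  define E where "E N = {x :: real ^ 'n. infinite (approximants (x $ i) m) \<and> (\<forall>j. \<bar>x $ j\<bar> \<le> real N)}" for N
  have null: "hausdorff_premeasure s \<delta> (E N) = 0" if \<delta>: "\<delta> > 0" for N \<delta>
  proof -
    \<comment> \<open>The added \<open>1\<close> absorbs the rounding down of negative
      coordinates.\<close>
    define K where "K q = nat \<lceil>N / h q\<rceil> + 1" for q
    \<comment> \<open>Coordinate \<open>i\<close> is located by the numerator; its grid index is
      fixed to \<open>0\<close> so that it does not enlarge the count.\<close>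
    define I where "I q = {-(int (N+1) * int q)..int (N+1) * int q} \<times>
       PiE (UNIV::'n set) (\<lambda>j. if j = i then {0} else {-int (K q)..int (K q)})" for q
    define box where "box q = (\<lambda>(p, \<kappa>). {x :: real ^ 'n. \<bar>x $ i - real_of_int p / q\<bar> \<le> h q \<and>
       (\<forall>j. j \<noteq> i \<longrightarrow> real_of_int (\<kappa> j) * h q \<le> x $ j \<and> x $ j \<le> (real_of_int (\<kappa> j) + 1) * h q)})" for q
    define C where "C = (2 * real N + 3) * (2 * real N + 5) ^ d * (2 * n) powr s"
    have C0: "C \<ge> 0" unfolding C_def using n1 by simp
    define f where "f q = C * real q powr (1 + m * d - m * s)" for q :: nat
    have f0: "f q \<ge> 0" for q unfolding f_def using C0 by simp
    have "summable f"
    proof -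
      have "n - 1 + 2 / m < s" using s by (simp add: n_def)
      then have "m * (real d + 2 / m) < m * s" using m d by simp
      then have "1 + m * d - m * s < -1" using m by (simp add: algebra_simps)
      then show ?thesis unfolding f_def by (intro summable_mult) (simp add: summable_real_powr_iff)
    qed
    have card_I: "real (card (I q)) \<le> (2 * real N + 3) * real q * ((2 * real N + 5) / h q) ^ d" if q: "q \<ge> 1" for q
    proof -
      have "card (PiE (UNIV::'n set) (\<lambda>j. if j = i then {0} else {-int (K q)..int (K q)}))
          = (\<Prod>j\<in>(UNIV::'n set). if j = i then 1 else 2 * K q + 1)"
        by (subst card_PiE) (auto intro!: prod.cong)
      also have "\<dots> = (\<Prod>j\<in>UNIV - {i}. 2 * K q + 1)"
        by (subst prod.remove[of _ i]) (auto intro!: prod.cong)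
      also have "\<dots> = (2 * K q + 1) ^ d" by (simp add: d_def card_Diff_singleton)
      finally have c: "card (I q) = (2 * ((N + 1) * q) + 1) * (2 * K q + 1) ^ d"
        unfolding I_def card_cartesian_product by (simp add: nat_add_distrib nat_mult_distrib algebra_simps)
      have "real (2 * ((N + 1) * q) + 1) \<le> (2 * real N + 3) * real q"
        using q by (simp add: algebra_simps)
      moreover have "real (2 * K q + 1) \<le> (2 * real N + 5) / h q"
      proof -
        have "real (K q) \<le> N / h q + 2" unfolding K_def using h[OF q] by simp linarith
        then have "real (2 * K q + 1) \<le> 2 * (N / h q) + 5 * 1" by simp
        also have "\<dots> \<le> 2 * (N / h q) + 5 * (1 / h q)" using h[OF q] by (intro add_left_mono mult_left_mono) auto
        finally show ?thesis by (simp add: add_divide_distrib)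
      qed
      ultimately show ?thesis unfolding c of_nat_mult of_nat_power by (intro mult_mono power_mono) auto
    qed
    have fin_I: "finite (I q)" for q unfolding I_def by (intro finite_cartesian_product finite_PiE) auto
    have boxes: "hausdorff_premeasure s \<delta> (\<Union>k\<in>I q. box q k) \<le> ennreal (f q)"
      if q: "q \<ge> 1" and small: "n * (2 * h q) \<le> \<delta>" for q
    proof -
      have b: "hausdorff_premeasure s \<delta> (box q k) \<le> ennreal ((n * (2 * h q)) powr s)" for k
      proof -
        have dev: "\<bar>x $ j - y $ j\<bar> \<le> 2 * h q" if "x \<in> box q k" "y \<in> box q k" for x y j
        proof (cases "j = i")
          case True
          then show ?thesis using that by (auto simp: box_def split: prod.splits)
        next
          case False
          define a where "a = real_of_int (snd k j)"
          have "a * h q \<le> x $ j" "x $ j \<le> (a + 1) * h q" "a * h q \<le> y $ j" "y $ j \<le> (a + 1) * h q"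
            using that False unfolding box_def a_def by (cases k; simp)+
          then show ?thesis using h[OF q] by (simp add: algebra_simps abs_le_iff)
        qed
        have bd: "bounded (box q k)" "diameter (box q k) \<le> n * (2 * h q)"
          unfolding n_def using diameter_le_coordinatewise[of "2 * h q" "box q k"] dev h[OF q] by auto
        have "hausdorff_premeasure s \<delta> (box q k) \<le> diam_weight s (box q k)"
          using bd small \<delta> by (intro hausdorff_premeasure_single) auto
        also have "\<dots> \<le> ennreal ((n * (2 * h q)) powr s)"
          using bd s0 by (intro diam_weight_le) auto
        finally show ?thesis .
      qed
      have "hausdorff_premeasure s \<delta> (\<Union>k\<in>I q. box q k) \<le> (\<Sum>k\<in>I q. hausdorff_premeasure s \<delta> (box q k))"
        using fin_I \<delta> by (intro hausdorff_premeasure_finite_UN_le) auto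
      also have "\<dots> \<le> (\<Sum>k\<in>I q. ennreal ((n * (2 * h q)) powr s))" by (intro sum_mono b)
      also have "\<dots> = ennreal (card (I q) * (n * (2 * h q)) powr s)"
        by (simp add: ennreal_of_nat_eq_real_of_nat ennreal_mult)
      also have "\<dots> \<le> ennreal ((2 * real N + 3) * real q * ((2 * real N + 5) / h q) ^ d * (n * (2 * h q)) powr s)"
        by (intro ennreal_leI mult_right_mono card_I q) auto
      also have "(2 * real N + 3) * real q * ((2 * real N + 5) / h q) ^ d * (n * (2 * h q)) powr s = f q"
      proof -
        have "(n * (2 * h q)) powr s = (2 * n) powr s * real q powr (- m * s)"
          using n1 h[OF q] unfolding h_def by (simp add: powr_mult powr_powr mult.assoc[symmetric] mult.commute[of n 2])
        moreover have "((2 * real N + 5) / h q) ^ d = (2 * real N + 5) ^ d * real q powr (m * d)"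
        proof -
          have "(2 * real N + 5) / h q = (2 * real N + 5) * real q powr m"
            using q by (simp add: h_def powr_minus field_simps)
          moreover have "(real q powr m) ^ d = real q powr (m * d)"
            using q by (simp add: powr_powr[symmetric] powr_realpow)
          ultimately show ?thesis by (simp add: power_mult_distrib)
        qed
        moreover have "real q * (real q powr (m * d) * real q powr (- m * s)) = real q powr (1 + m * d - m * s)"
        proof -
          have "1 + m * d - m * s = 1 + (m * d + (- m * s))" by simp
          then show ?thesis using q by (simp only: powr_add) simp
        qed
        ultimately show ?thesis unfolding f_def C_def by (simp add: mult_ac)
      qed
      finally show ?thesis .
    qed
    have cover: "\<exists>k\<in>I q. x \<in> box q k"
      if q: "q \<ge> 1" and x: "\<And>j. \<bar>x $ j\<bar> \<le> N" and p: "\<bar>x $ i - real_of_int p / q\<bar> \<le> h q" for q x p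
    proof -
      define \<kappa> where "\<kappa> j = (if j = i then 0 else \<lfloor>x $ j / h q\<rfloor>)" for j
      have "\<bar>real_of_int p / q\<bar> \<le> real N + 1" using p x[of i] h[OF q] by linarith
      then have "\<bar>real_of_int p\<bar> \<le> (real N + 1) * real q" using q by (simp add: abs_divide field_simps)
      then have "\<bar>real_of_int p\<bar> \<le> real_of_int (int (N + 1) * int q)" by (simp add: algebra_simps)
      then have "\<bar>p\<bar> \<le> int (N + 1) * int q" by linarith
      moreover have "\<kappa> j \<in> {-int (K q)..int (K q)}" if "j \<noteq> i" for j
      proof -
        have "\<bar>x $ j / h q\<bar> \<le> N / h q" using x[of j] h[OF q] by (simp add: abs_divide divide_right_mono)
        moreover have "N / h q \<le> real (K q) - 1" unfolding K_def using h[OF q] by simp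
        ultimately have "\<bar>x $ j / h q\<bar> \<le> real (K q) - 1" by linarith
        then have "- int (K q) \<le> \<lfloor>x $ j / h q\<rfloor>" "\<lfloor>x $ j / h q\<rfloor> \<le> int (K q)" by linarith+
        then show ?thesis using that by (simp add: \<kappa>_def)
      qed
      then have "\<kappa> \<in> PiE (UNIV::'n set) (\<lambda>j. if j = i then {0} else {-int (K q)..int (K q)})"
        by (auto simp: PiE_def Pi_def extensional_def \<kappa>_def)
      ultimately have "(p, \<kappa>) \<in> I q" unfolding I_def by (auto simp: abs_le_iff)
      moreover have "x \<in> box q (p, \<kappa>)"
      proof -
        have "real_of_int (\<kappa> j) * h q \<le> x $ j \<and> x $ j \<le> (real_of_int (\<kappa> j) + 1) * h q" if "j \<noteq> i" for j
        proof -
          have "real_of_int (\<kappa> j) \<le> x $ j / h q" "x $ j / h q \<le> real_of_int (\<kappa> j) + 1"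
            using that unfolding \<kappa>_def by (simp; linarith)+
          then show ?thesis using h[OF q] by (simp add: field_simps)
        qed
        then show ?thesis using p unfolding box_def by simp
      qed
      ultimately show ?thesis by blast
    qed
    have "hausdorff_premeasure s \<delta> (E N) \<le> 0"
    proof (rule ennreal_le_epsilon)
      fix e :: real assume e: "e > 0"
      obtain q1 where q1: "\<And>q. q \<ge> q1 \<Longrightarrow> norm (\<Sum>k. f (k + q)) < e"
        using suminf_exist_split[OF e \<open>summable f\<close>] by blast
      have "(\<lambda>q. n * (2 * h q)) \<longlonglongrightarrow> n * (2 * 0)"
        unfolding h_def by (intro tendsto_intros tendsto_neg_powr filterlim_real_sequentially) (use m in auto)
      then have "eventually (\<lambda>q. n * (2 * h q) < \<delta>) sequentially"
        using \<delta> by (intro order_tendstoD(2)) auto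
      then obtain q2 where q2: "\<And>q. q \<ge> q2 \<Longrightarrow> n * (2 * h q) < \<delta>"
        unfolding eventually_sequentially by blast
      \<comment> \<open>Beyond \<open>q1\<close> the tail of the series is below \<open>e\<close>,
        beyond \<open>q2\<close> the boxes are small enough, and the \<open>1\<close> excludes
        denominator \<open>0\<close>.\<close>
      define q0 where "q0 = q1 + q2 + 1"
      have "E N \<subseteq> (\<Union>t. \<Union>k\<in>I (t + q0). box (t + q0) k)"
      proof
        fix x assume x: "x \<in> E N"
        then have "infinite (approximants (x $ i) m)" by (simp add: E_def)
        then obtain p :: int and q :: nat
          where pq: "q > q0" "q \<ge> 1" "\<bar>x $ i - real_of_int p / real q\<bar> \<le> real q powr (-m)"
          by (rule infinite_approximants_large[OF _ less_imp_le[OF m]])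
        then obtain k where "k \<in> I q" "x \<in> box q k"
          using cover[of q x p] x unfolding E_def h_def by auto
        then have "\<exists>t. \<exists>k\<in>I (t + q0). x \<in> box (t + q0) k"
          using pq(1) by (intro exI[of _ "q - q0"]) auto
        then show "x \<in> (\<Union>t. \<Union>k\<in>I (t + q0). box (t + q0) k)" by blast
      qed
      then have "hausdorff_premeasure s \<delta> (E N) \<le> hausdorff_premeasure s \<delta> (\<Union>t. \<Union>k\<in>I (t + q0). box (t + q0) k)"
        by (rule hausdorff_premeasure_mono)
      also have "\<dots> \<le> (\<Sum>t. hausdorff_premeasure s \<delta> (\<Union>k\<in>I (t + q0). box (t + q0) k))"
        by (rule hausdorff_premeasure_UN_le)
      also have "\<dots> \<le> (\<Sum>t. ennreal (f (t + q0)))"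
        by (intro suminf_le boxes) (auto simp: q0_def intro!: less_imp_le q2)
      also have "\<dots> = ennreal (\<Sum>t. f (t + q0))"
        using \<open>summable f\<close> f0 by (intro suminf_ennreal2) (auto simp: summable_iff_shift)
      also have "\<dots> \<le> ennreal e"
        using q1[of q0] by (intro ennreal_leI) (auto simp: q0_def)
      finally show "hausdorff_premeasure s \<delta> (E N) \<le> 0 + ennreal e" by simp
    qed
    then show ?thesis by simp
  qed
  have "{x :: real ^ 'n. infinite (approximants (x $ i) m)} = (\<Union>N. E N)"
  proof -
    have "\<exists>N::nat. \<forall>j. \<bar>x $ j\<bar> \<le> N" for x :: "real ^ 'n"
    proof -
      obtain N :: nat where "norm x \<le> N" using real_arch_simple by blast
      then show ?thesis using component_le_norm_cart[of x] order_trans by blast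
    qed
    then show ?thesis unfolding E_def by blast
  qed
  then show ?thesis
    using null hausdorff_measure_null_UN[of s E] unfolding hausdorff_measure_eq_0_iff by simp
qed

subsection \<open>Shifts into prescribed exponent classes\<close>

lemma coprime_fraction_dvd:
  fixes p p' :: int and q X :: nat
  assumes "coprime p' (int X)" "X \<ge> 1" "q \<ge> 1" "real_of_int p / q = real_of_int p' / X"
  shows "X dvd q"
proof -
  have "real_of_int (p * int X) = real_of_int (p' * int q)" using assms by (simp add: field_simps)
  then have "p * int X = p' * int q" unfolding of_int_eq_iff .
  then have "int X dvd p' * int q" by (metis dvd_triv_right)
  then have "int X dvd int q" using assms(1) by (simp add: coprime_dvd_mult_right_iff coprime_commute)
  then show ?thesis by simp
qed

text \<open>Reduced fractions with different denominators are different numbers, so infinitely many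
  indices give infinitely many approximants.\<close>

lemma infinite_approximants_seq:
  fixes p :: "nat \<Rightarrow> int" and X :: "nat \<Rightarrow> nat"
  assumes J: "infinite J" and X: "strict_mono X" "\<And>j. X j \<ge> 1" and cop: "\<And>j. coprime (p j) (int (X j))"
    and near: "\<And>j. j \<in> J \<Longrightarrow> \<bar>x - p j / X j\<bar> \<le> real (X j) powr (-m)"
  shows "infinite (approximants x m)"
proof
  assume "finite (approximants x m)"
  moreover have "(\<lambda>j. p j / X j) ` J \<subseteq> approximants x m"
    using near X unfolding approximants_def by blast
  moreover have "inj_on (\<lambda>j. p j / X j) J"
  proof (rule inj_onI)
    fix i j assume "p i / X i = p j / X j"
    then have "X i = X j"
      using coprime_fraction_dvd[of "p j" "X j" "X i" "p i"] coprime_fraction_dvd[of "p i" "X i" "X j" "p j"] X cop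
      by (intro dvd_antisym) auto
    then show "i = j" using X(1) by (simp add: strict_mono_eq)
  qed
  ultimately show False using J finite_imageD finite_subset by blast
qed

text \<open>A rational other than \<open>p j / X j\<close> with denominator well below \<open>X j\<close> to the power \<open>lam - 1\<close>
  stays at distance of order \<open>1 / (q * X j)\<close>; the least such \<open>j\<close> is bounded in terms of \<open>q\<close>.\<close>

lemma irrationality_exponent_seq_le:
  fixes p :: "nat \<Rightarrow> int" and X :: "nat \<Rightarrow> nat" and lam Lam C x :: real
  assumes lam: "lam \<ge> 2" and Lam: "Lam \<ge> 0" and C: "C \<ge> 1"
    and X: "strict_mono X" "\<And>j. X j \<ge> 1" and cop: "\<And>j. coprime (p j) (int (X j))"
    and growth: "\<And>j. real (X (Suc j)) \<le> C * real (X j) powr Lam"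
    and near: "\<And>j. \<bar>x - p j / X j\<bar> \<le> real (X j) powr (-lam)"
    and far: "\<And>j. real (X j) powr (-lam) / 2 \<le> \<bar>x - p j / X j\<bar>"
  shows "irrationality_exponent x \<le> ereal (max lam (Lam / (lam - 1) + 1))"
proof (rule irrationality_exponent_le)
  fix m assume "m > max lam (Lam / (lam - 1) + 1)"
  define th where "th = Lam / (lam - 1)"
  have m: "m > lam" "m > th + 1" and th: "th \<ge> 0"
    using \<open>m > _\<close> lam Lam by (auto simp: th_def)
  have "filterlim (\<lambda>q::nat. real q powr (m - lam)) at_top at_top"
    using m by (intro filterlim_compose[OF real_powr_at_top filterlim_real_sequentially]) auto
  moreover have "filterlim (\<lambda>q::nat. real q powr (m - 1 - th)) at_top at_top"
    using m by (intro filterlim_compose[OF real_powr_at_top filterlim_real_sequentially]) auto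
  ultimately have "eventually (\<lambda>q::nat. 3 \<le> real q powr (m - lam)) at_top"
    "eventually (\<lambda>q::nat. 3 * C * 2 powr th \<le> real q powr (m - 1 - th)) at_top"
    unfolding filterlim_at_top by blast+
  \<comment> \<open>Thresholds for \<open>q\<close>: the first makes the least index
    \<open>j\<close> below positive, the second excludes the fraction \<open>p j / X j\<close>
    itself, the third all other fractions. The factor \<open>3\<close> contradicts the factor
    \<open>2\<close> that is derived in either case.\<close>
  with eventually_ge_at_top[of "nat \<lceil>real (X 0) powr (lam - 1) / 2\<rceil>"]
  have "eventually (\<lambda>q::nat. real (X 0) powr (lam - 1) / 2 \<le> q \<and>
      3 \<le> real q powr (m - lam) \<and> 3 * C * 2 powr th \<le> real q powr (m - 1 - th)) at_top"
    by eventually_elim (auto simp: nat_le_iff ceiling_le_iff)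
  then obtain B :: nat where B: "\<And>q. q \<ge> B \<Longrightarrow> real (X 0) powr (lam - 1) / 2 \<le> real q"
    "\<And>q. q \<ge> B \<Longrightarrow> 3 \<le> real q powr (m - lam)"
    "\<And>q. q \<ge> B \<Longrightarrow> 3 * C * 2 powr th \<le> real q powr (m - 1 - th)"
    unfolding eventually_sequentially by blast
  show "finite (approximants x m)"
  proof (rule finite_approximants)
    fix a :: int and q :: nat
    assume q: "q \<ge> 1" and a: "\<bar>x - a / q\<bar> \<le> real q powr (-m)"
    show "q \<le> B"
    proof (rule ccontr)
      assume "\<not> q \<le> B"
      then have qB: "q \<ge> B" by simp
      have ex: "\<exists>j. real q < real (X j) powr (lam - 1) / 2"
      proof -
        have "filterlim X at_top sequentially" by (rule filterlim_subseq[OF X(1)])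
        then have "filterlim (\<lambda>j. real (X j)) at_top sequentially"
          by (rule filterlim_compose[OF filterlim_real_sequentially])
        then have "filterlim (\<lambda>j. real (X j) powr (lam - 1)) at_top sequentially"
          using lam by (intro filterlim_compose[OF real_powr_at_top]) auto
        then have "eventually (\<lambda>j. 2 * real q + 1 \<le> real (X j) powr (lam - 1)) sequentially"
          unfolding filterlim_at_top by blast
        then obtain j where "2 * real q + 1 \<le> real (X j) powr (lam - 1)" by (auto dest!: eventually_happens)
        then show ?thesis by (intro exI[of _ j]) linarith
      qed
      define j where "j = (LEAST j. real q < real (X j) powr (lam - 1) / 2)"
      have j: "real q < real (X j) powr (lam - 1) / 2" unfolding j_def by (rule LeastI_ex[OF ex])
      then obtain i where i: "j = Suc i" using B(1)[OF qB] by (cases j) auto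
      have "\<not> real q < real (X i) powr (lam - 1) / 2"
        using not_less_Least[of i "\<lambda>j. real q < real (X j) powr (lam - 1) / 2"] i by (simp add: j_def)
      then have Xi: "real (X i) powr (lam - 1) \<le> 2 * q" by simp
      have Xj: "real (X j) \<ge> 1" using X(2)[of j] by simp
      show False
      proof (cases "real_of_int a / q = real_of_int (p j) / X j")
        case True
        \<comment> \<open>The reduced denominator divides \<open>q\<close>, so by \<open>far\<close>
          the fraction \<open>a / q\<close> is no closer to \<open>x\<close> than
          \<open>q powr (-lam) / 2\<close>.\<close>
        have "X j \<le> q" using coprime_fraction_dvd[OF cop X(2) q True] q by (simp add: dvd_imp_le)
        then have "real q powr (-lam) / 2 \<le> real (X j) powr (-lam) / 2"
          using lam Xj by (intro divide_right_mono powr_mono2') auto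
        also have "\<dots> \<le> real q powr (-m)" using far[of j] a unfolding True by linarith
        finally have "real q powr (-lam) / 2 * real q powr m \<le> real q powr (-m) * real q powr m"
          by (intro mult_right_mono) auto
        then have "real q powr (m - lam) \<le> 2" using q by (simp add: powr_add[symmetric])
        then show False using B(2)[OF qB] by linarith
      next
        case False
        \<comment> \<open>By the choice of \<open>j\<close> the error of \<open>p j / X j\<close> is
          at most half of the gap \<open>1 / (q * X j)\<close>, so \<open>a / q\<close> keeps the
          other half as its distance from \<open>x\<close>.\<close>
        have "real (X j) powr (-lam) = 1 / (real (X j) powr (lam - 1) * X j)"
          using Xj by (simp add: powr_minus_divide powr_diff)
        also have "\<dots> \<le> 1 / (2 * real q * X j)"
          using j q Xj by (intro divide_left_mono mult_right_mono) auto
        finally have 1: "real (X j) powr (-lam) \<le> 1 / (2 * real q * X j)" .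
        have "1 / (real q * X j) \<le> \<bar>a / q - p j / X j\<bar>"
          by (rule distinct_fractions_dist[OF q X(2) False])
        also have "\<dots> \<le> real q powr (-m) + real (X j) powr (-lam)"
          using a near[of j] by linarith
        finally have 2: "1 / (2 * real q * X j) \<le> real q powr (-m)" using 1 q Xj by (simp add: field_simps)
        \<comment> \<open>Minimality of \<open>j\<close> bounds \<open>X i\<close> in terms of
          \<open>q\<close>, and \<open>growth\<close> carries the bound over to
          \<open>X j\<close>.\<close>
        have "real (X i) powr Lam = (real (X i) powr (lam - 1)) powr th"
          using lam by (simp add: powr_powr th_def)
        also have "\<dots> \<le> (2 * q) powr th" using Xi th by (intro powr_mono2) auto
        finally have "real (X j) \<le> C * (2 * q) powr th"
          using growth[of i] C unfolding i by (meson mult_left_mono order_trans zero_le_one)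
        then have "1 / (2 * real q * (C * (2 * q) powr th)) \<le> 1 / (2 * real q * X j)"
          using q Xj C by (intro divide_left_mono mult_left_mono mult_pos_pos) auto
        with 2 have "1 / (2 * real q * (C * (2 * q) powr th)) \<le> real q powr (-m)" by linarith
        then have "1 \<le> real q powr (-m) * (2 * real q * (C * (2 * q) powr th))"
          using q C by (subst (asm) divide_le_eq) (auto intro!: mult_pos_pos)
        also have "\<dots> = 2 * C * 2 powr th * (real q powr (-m) * real q powr 1 * real q powr th)"
          using q by (simp add: powr_mult)
        also have "real q powr (-m) * real q powr 1 * real q powr th = 1 / real q powr (m - 1 - th)"
          unfolding powr_add[symmetric] powr_minus_divide[symmetric]
          by (rule arg_cong[where f="\<lambda>e. real q powr e"]) simp
        finally have "real q powr (m - 1 - th) \<le> 2 * C * 2 powr th"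
          using q by (subst (asm) times_divide_eq_right) (subst (asm) le_divide_eq, auto)
        moreover have "2 * C * 2 powr th < 3 * C * 2 powr th" using C by simp
        ultimately show False using B(3)[OF qB] by linarith
      qed
    qed
  qed (use m lam in auto)
qed

text \<open>Exponents of two: odd numerators are then coprime to the denominators. The
  \<open>3\<close> gives the growth factor \<open>8\<close>, rounding up costs at most another
  factor \<open>2\<close>, and the start \<open>2\<close> gives the first denominator
  \<open>4\<close>, which later confines the shift to \<open>[0,1]\<close>.\<close>

primrec dyad_exp :: "(nat \<Rightarrow> real) \<Rightarrow> nat \<Rightarrow> nat" where
  "dyad_exp al 0 = 2"
| "dyad_exp al (Suc k) = nat \<lceil>3 + al k * real (dyad_exp al k)\<rceil>"

definition dyad :: "(nat \<Rightarrow> real) \<Rightarrow> nat \<Rightarrow> nat" where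
  "dyad al k = 2 ^ dyad_exp al k"

lemma dyad_ge_1: "dyad al k \<ge> 1" by (simp add: dyad_def)

lemma dyad_Suc:
  assumes "al k \<ge> 0"
  shows "8 * real (dyad al k) powr al k \<le> dyad al (Suc k)" "dyad al (Suc k) \<le> 16 * real (dyad al k) powr al k"
proof -
  let ?e = "3 + al k * real (dyad_exp al k)"
  have e: "?e \<ge> 0" using assms by simp
  then have "\<lceil>?e\<rceil> \<ge> 0" by linarith
  then have "real (dyad_exp al (Suc k)) = real_of_int \<lceil>?e\<rceil>" by simp
  then have b: "?e \<le> dyad_exp al (Suc k)" "dyad_exp al (Suc k) \<le> ?e + 1" by linarith+
  have Q: "real (dyad al j) = 2 powr real (dyad_exp al j)" for j by (simp add: dyad_def powr_realpow)
  have "2 powr ?e = 8 * real (dyad al k) powr al k"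
    unfolding Q by (simp add: powr_add powr_powr mult.commute)
  then show "8 * real (dyad al k) powr al k \<le> dyad al (Suc k)" "dyad al (Suc k) \<le> 16 * real (dyad al k) powr al k"
    unfolding Q[of "Suc k"] using powr_mono[OF b(1), of 2] powr_mono[OF b(2), of 2] by (auto simp: powr_add)
qed

lemma dyad_strict_mono:
  assumes "\<And>k. al k \<ge> 1" shows "strict_mono (dyad al)"
proof (rule strict_mono_Suc_iff[THEN iffD2], intro allI)
  fix k
  have "real (dyad al k) powr 1 \<le> real (dyad al k) powr al k"
    using dyad_ge_1[of al k] assms by (intro powr_mono) auto
  then have "real (dyad al k) < 8 * real (dyad al k) powr al k" using dyad_ge_1[of al k] by simp
  also have "\<dots> \<le> dyad al (Suc k)" using dyad_Suc(1)[of al k] assms[of k] by simp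
  finally show "dyad al k < dyad al (Suc k)" by simp
qed

text \<open>Exponents multiply along \<open>n\<close> steps. Each step raises the constant to the
  power \<open>al (k + n)\<close>, and the uniform bound \<open>B\<close> keeps it independent of
  \<open>k\<close>.\<close>

lemma dyad_growth:
  assumes al: "\<And>k. al k \<ge> 1" "\<And>k. al k \<le> B"
  shows "\<exists>C\<ge>1. \<forall>k. real (dyad al (k + n)) \<le> C * real (dyad al k) powr (\<Prod>j<n. al (k + j))"
proof (induction n)
  case 0
  show ?case by (intro exI[of _ 1]) simp
next
  case (Suc n)
  then obtain C where C: "C \<ge> 1" "\<And>k. real (dyad al (k + n)) \<le> C * real (dyad al k) powr (\<Prod>j<n. al (k + j))"
    by blast
  have B: "B \<ge> 1" using al order_trans by blast
  show ?case
  proof (intro exI[of _ "16 * C powr B"] conjI allI)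
    show "1 \<le> 16 * C powr B" using C B ge_one_powr_ge_zero[of C B] by simp
    fix k
    let ?a = "al (k + n)" and ?q = "real (dyad al k)" and ?w = "\<Prod>j<n. al (k + j)"
    have a: "?a \<ge> 1" by (rule al)
    have "real (dyad al (k + Suc n)) \<le> 16 * real (dyad al (k + n)) powr ?a"
      using dyad_Suc(2)[of al "k + n"] a by simp
    also have "\<dots> \<le> 16 * (C * ?q powr ?w) powr ?a"
      using C(2)[of k] a by (intro mult_left_mono powr_mono2) auto
    also have "\<dots> = 16 * (C powr ?a * ?q powr (?w * ?a))"
      using C(1) by (simp add: powr_mult powr_powr)
    also have "\<dots> \<le> 16 * (C powr B * ?q powr (?w * ?a))"
      using C(1) al by (intro mult_left_mono mult_right_mono powr_mono) auto
    finally show "real (dyad al (k + Suc n)) \<le> 16 * C powr B * ?q powr (\<Prod>j<Suc n. al (k + j))"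
      by (simp add: mult.assoc)
  qed
qed

section \<open>Nested intervals for the simultaneous shift\<close>

lemma ex_odd_in_interval: "\<exists>p::int. odd p \<and> z \<le> real_of_int p \<and> real_of_int p \<le> z + 2"
proof (cases "odd \<lceil>z\<rceil>")
  case True then show ?thesis by (intro exI[of _ "\<lceil>z\<rceil>"]) linarith
next
  case False
  then have "odd (\<lceil>z\<rceil> + 1)" by simp
  then show ?thesis by (intro exI[of _ "\<lceil>z\<rceil> + 1"]) (auto; linarith)
qed

text \<open>The shift lies in nested intervals \<open>[a k, a k + 4 / Q k]\<close>. At the next left
  end the error \<open>y k - t - p / Q k\<close> equals \<open>h k\<close>; as the next length is at
  most \<open>h k / 2\<close>, the error stays between \<open>h k / 2\<close> and \<open>h k\<close>
  on the whole interval.\<close>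

lemma ex_simultaneous_shift:
  fixes al y :: "nat \<Rightarrow> real"
  assumes al: "\<And>k. al k \<ge> 1"
  obtains t p where "0 \<le> t" "t \<le> 1" "\<And>k. odd (p k :: int)"
    "\<And>k. real (dyad al k) powr (- al k) / 2 \<le> y k - t - p k / dyad al k"
    "\<And>k. y k - t - p k / dyad al k \<le> real (dyad al k) powr (- al k)"
proof -
  define Q where "Q k = real (dyad al k)" for k
  define h where "h k = Q k powr (- al k)" for k
  have Q: "Q k \<ge> 1" for k using dyad_ge_1[of al k] by (simp add: Q_def)
  have h0: "h k > 0" for k using Q[of k] by (simp add: h_def)
  have h1: "h k \<le> 1 / Q k" for k
    using powr_mono[of "- al k" "-1" "Q k"] al[of k] Q[of k] by (simp add: h_def powr_minus_divide)
  have step: "4 / Q (Suc k) \<le> h k / 2" for k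
  proof -
    have "8 * Q k powr al k \<le> Q (Suc k)" using dyad_Suc(1)[of al k] al[of k] by (simp add: Q_def)
    then have "4 / Q (Suc k) \<le> 4 / (8 * Q k powr al k)"
      using Q[of k] Q[of "Suc k"] by (intro divide_left_mono mult_pos_pos) auto
    then show ?thesis by (simp add: h_def powr_minus_divide)
  qed
  let ?P = "\<lambda>k a. k = 0 \<longrightarrow> a = (0::real)"
  let ?R = "\<lambda>k a a'. a \<le> a' \<and> a' + 4 / Q (Suc k) \<le> a + 4 / Q k \<and>
     (\<exists>p::int. odd p \<and> a' = y k - p / Q k - h k)"
  have "\<exists>a. \<forall>k. ?P k (a k) \<and> ?R k (a k) (a (Suc k))"
  proof (rule dependent_nat_choice)
    show "\<exists>a. ?P 0 a" by simp
    fix a k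
    \<comment> \<open>This window puts \<open>y k - p / Q k\<close> between
      \<open>a + 2 / Q k\<close> and \<open>a + 4 / Q k\<close>. Subtracting
      \<open>h k \<le> 1 / Q k\<close> stays to the right of \<open>a\<close>, and the next
      interval, of length at most \<open>h k / 2\<close>, still fits.\<close>
    obtain p :: int where p: "odd p" "Q k * (y k - a) - 4 \<le> p" "p \<le> Q k * (y k - a) - 2"
      using ex_odd_in_interval[of "Q k * (y k - a) - 4"] by auto
    have "(y k - a) - 4 / Q k \<le> p / Q k" "p / Q k \<le> (y k - a) - 2 / Q k"
      using divide_right_mono[OF p(2), of "Q k"] divide_right_mono[OF p(3), of "Q k"] Q[of k]
      by (simp_all add: diff_divide_distrib)
    moreover have "2 / Q k = 2 * (1 / Q k)" "4 / Q k = 4 * (1 / Q k)" "0 < 1 / Q k" using Q[of k] by simp_all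
    ultimately have "a \<le> y k - p / Q k - h k" "y k - p / Q k - h k + 4 / Q (Suc k) \<le> a + 4 / Q k"
      using h1[of k] step[of k] h0[of k] by linarith+
    then show "\<exists>a'. ?P (Suc k) a' \<and> ?R k a a'" using p(1) by blast
  qed
  then obtain a where a: "a 0 = 0" "\<And>k. a k \<le> a (Suc k)" "\<And>k. a (Suc k) + 4 / Q (Suc k) \<le> a k + 4 / Q k"
    "\<And>k. \<exists>p::int. odd p \<and> a (Suc k) = y k - p / Q k - h k"
    by metis
  then obtain p :: "nat \<Rightarrow> int" where p: "\<And>k. odd (p k)" "\<And>k. a (Suc k) = y k - p k / Q k - h k"
    by metis
  have inc: "incseq a" using a(2) by (rule incseq_SucI)
  have dec: "a j + 4 / Q j \<le> a k + 4 / Q k" if "k \<le> j" for j k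
    using that by (induction j rule: dec_induct) (use a(3) order_trans in blast)+
  have up: "a j \<le> a k + 4 / Q k" for j k
  proof (cases "k \<le> j")
    case True
    have "0 \<le> 4 / Q j" using Q[of j] by simp
    then show ?thesis using dec[OF True] by linarith
  next
    case False
    then have "a j \<le> a k" using inc by (simp add: incseqD)
    moreover have "0 \<le> 4 / Q k" using Q[of k] by simp
    ultimately show ?thesis by linarith
  qed
  obtain t where t: "a \<longlonglongrightarrow> t" "\<And>k. a k \<le> t"
    using incseq_convergent[OF inc, of "a 0 + 4 / Q 0"] up by blast
  have t': "t \<le> a k + 4 / Q k" for k
    by (rule LIMSEQ_le_const2[OF t(1)]) (use up in blast)
  show ?thesis
  proof (rule that[of t p])
    show "0 \<le> t" using t(2)[of 0] a(1) by simp
    show "t \<le> 1" using t'[of 0] a(1) by (simp add: Q_def dyad_def)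
    fix k
    show "odd (p k)" by (rule p)
    show "real (dyad al k) powr (- al k) / 2 \<le> y k - t - p k / dyad al k"
      using t'[of "Suc k"] step[of k] p(2)[of k] unfolding h_def Q_def[of k] by linarith
    show "y k - t - p k / dyad al k \<le> real (dyad al k) powr (- al k)"
      using t(2)[of "Suc k"] p(2)[of k] unfolding h_def Q_def[of k] by linarith
  qed
qed

lemma odd_coprime_dyad: "odd p \<Longrightarrow> coprime p (int (dyad al k))"
  by (simp add: dyad_def)

text \<open>Moving the window by one drops \<open>al k\<close> and gains \<open>al (k + n)\<close>,
  which is the same factor.\<close>

lemma cyclic_prod:
  fixes al :: "nat \<Rightarrow> real"
  assumes nz: "\<And>k. al k \<noteq> 0" and per: "\<And>k. al (k + n) = al k"
  shows "(\<Prod>j<n. al (k + j)) = (\<Prod>j<n. al j)"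
proof (induction k)
  case (Suc k)
  have "al k * (\<Prod>j<n. al (Suc k + j)) = (\<Prod>j<Suc n. al (k + j))"
    by (simp add: prod.lessThan_Suc_shift del: prod.lessThan_Suc)
  also have "\<dots> = al k * (\<Prod>j<n. al (k + j))" by (simp add: per)
  finally show ?case using Suc nz[of k] by simp
qed simp

text \<open>Coordinates are served in turn with periodic exponents. Between two turns of one
  coordinate every \<open>lam j\<close> acts once, so its denominators grow with the full product as
  exponent.\<close>

lemma shift_into_exponent_classes:
  fixes lam :: "'n::finite \<Rightarrow> real" and y :: "real ^ 'n"
  assumes lam: "\<And>i. lam i \<ge> 2"
  obtains t where "0 \<le> t" "t \<le> 1"
    "\<And>i. ereal (lam i) \<le> irrationality_exponent (y $ i - t)"
    "\<And>i. irrationality_exponent (y $ i - t) \<le> ereal (max (lam i) ((\<Prod>j\<in>UNIV. lam j) / (lam i - 1) + 1))"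
proof -
  define n where "n = CARD('n)"
  have n: "n > 0" unfolding n_def by simp
  obtain e where e: "bij_betw e {0..<n} (UNIV :: 'n set)"
    using ex_bij_betw_nat_finite[of "UNIV :: 'n set"] unfolding n_def by auto
  define al where "al k = lam (e (k mod n))" for k
  have al: "al k \<ge> 2" "al k \<le> Max (range lam)" for k unfolding al_def using lam by auto
  have al1: "al k \<ge> 1" for k using al(1)[of k] by linarith
  have Lam: "(\<Prod>j<n. al (k + j)) = (\<Prod>j\<in>UNIV. lam j)" for k
  proof -
    have "(\<Prod>j<n. al (k + j)) = (\<Prod>j<n. al j)"
    proof (rule cyclic_prod)
      show "al k \<noteq> 0" "al (k + n) = al k" for k using al1[of k] by (auto simp: al_def)
    qed
    also have "\<dots> = (\<Prod>j\<in>{0..<n}. lam (e j))" by (intro prod.cong) (auto simp: al_def)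
    also have "\<dots> = (\<Prod>j\<in>UNIV. lam j)" by (rule prod.reindex_bij_betw[OF e])
    finally show ?thesis .
  qed
  obtain C where C: "C \<ge> 1" "\<And>k. real (dyad al (k + n)) \<le> C * real (dyad al k) powr (\<Prod>j\<in>UNIV. lam j)"
    using dyad_growth[of al "Max (range lam)" n] al al1 unfolding Lam by blast
  obtain t and p :: "nat \<Rightarrow> int" where t: "0 \<le> t" "t \<le> 1" "\<And>k. odd (p k)"
    "\<And>k. real (dyad al k) powr (- al k) / 2 \<le> y $ e (k mod n) - t - p k / dyad al k"
    "\<And>k. y $ e (k mod n) - t - p k / dyad al k \<le> real (dyad al k) powr (- al k)"
    using ex_simultaneous_shift[of al "\<lambda>k. y $ e (k mod n)"] al1 by blast
  have *: "ereal (lam i) \<le> irrationality_exponent (y $ i - t) \<and>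
    irrationality_exponent (y $ i - t) \<le> ereal (max (lam i) ((\<Prod>j\<in>UNIV. lam j) / (lam i - 1) + 1))" for i
  proof -
    obtain r where r: "r < n" "e r = i"
      using bij_betw_imp_surj_on[OF e] by (metis UNIV_I atLeastLessThan_iff imageE)
    define k where "k j = r + j * n" for j
    have km: "e (k j mod n) = i" "al (k j) = lam i" for j using r by (simp_all add: k_def al_def)
    have k_mono: "strict_mono k" unfolding k_def using n by (intro strict_monoI) simp
    have X: "strict_mono (\<lambda>j. dyad al (k j))"
      using strict_mono_compose[OF dyad_strict_mono k_mono] al1 by simp
    have far: "real (dyad al (k j)) powr (- lam i) / 2 \<le> \<bar>(y $ i - t) - p (k j) / dyad al (k j)\<bar>" for j
      using t(4)[of "k j"] abs_ge_self[of "(y $ i - t) - p (k j) / dyad al (k j)"] unfolding km by linarith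
    have near: "\<bar>(y $ i - t) - p (k j) / dyad al (k j)\<bar> \<le> real (dyad al (k j)) powr (- lam i)" for j
      using t(4)[of "k j"] t(5)[of "k j"] km[of j] powr_ge_zero[of "real (dyad al (k j))" "- lam i"]
      by (simp add: abs_le_iff)
    have "infinite (approximants (y $ i - t) (lam i))"
      by (rule infinite_approximants_seq[where J=UNIV and X="\<lambda>j. dyad al (k j)" and p="\<lambda>j. p (k j)"])
         (use X near dyad_ge_1 odd_coprime_dyad t in auto)
    moreover have "irrationality_exponent (y $ i - t) \<le> ereal (max (lam i) ((\<Prod>j\<in>UNIV. lam j) / (lam i - 1) + 1))"
    proof (rule irrationality_exponent_seq_le[where X="\<lambda>j. dyad al (k j)" and p="\<lambda>j. p (k j)"])
      show "0 \<le> (\<Prod>j\<in>UNIV. lam j)" using lam by (intro prod_nonneg) (auto intro: order_trans[of 0 2])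
      show "real (dyad al (k (Suc j))) \<le> C * real (dyad al (k j)) powr (\<Prod>j\<in>UNIV. lam j)" for j
        using C(2)[of "k j"] by (simp add: k_def add_ac)
    qed (use lam C X near far dyad_ge_1 odd_coprime_dyad t in auto)
    ultimately show ?thesis using le_irrationality_exponent by blast
  qed
  show ?thesis by (rule that[of t]) (use t * in auto)
qed

text \<open>The exponents \<open>al k = k + 1\<close> increase without bound while every coordinate
  keeps having its turn.\<close>

lemma shift_into_liouville:
  fixes y :: "real ^ 'n::finite"
  obtains t where "0 \<le> t" "t \<le> 1" "\<And>i. irrationality_exponent (y $ i - t) = \<infinity>"
proof -
  define n where "n = CARD('n)"
  have n: "n > 0" unfolding n_def by simp
  obtain e where e: "bij_betw e {0..<n} (UNIV :: 'n set)"
    using ex_bij_betw_nat_finite[of "UNIV :: 'n set"] unfolding n_def by auto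
  define al where "al k = real k + 1" for k
  have al1: "al k \<ge> 1" for k by (simp add: al_def)
  obtain t and p :: "nat \<Rightarrow> int" where t: "0 \<le> t" "t \<le> 1" "\<And>k. odd (p k)"
    "\<And>k. real (dyad al k) powr (- al k) / 2 \<le> y $ e (k mod n) - t - p k / dyad al k"
    "\<And>k. y $ e (k mod n) - t - p k / dyad al k \<le> real (dyad al k) powr (- al k)"
    using ex_simultaneous_shift[of al "\<lambda>k. y $ e (k mod n)"] al1 by blast
  have inf: "infinite (approximants (y $ i - t) (real m))" for i m
  proof -
    obtain r where r: "r < n" "e r = i"
      using bij_betw_imp_surj_on[OF e] by (metis UNIV_I atLeastLessThan_iff imageE)
    \<comment> \<open>The turns of coordinate \<open>i\<close> from cycle \<open>m\<close> on; there
      \<open>k \<ge> m\<close> and hence \<open>al k \<ge> m\<close>.\<close>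
    define J where "J = (\<lambda>j. r + (m + j) * n) ` UNIV"
    have J: "infinite J" unfolding J_def using n by (intro range_inj_infinite) (auto intro!: injI)
    have near: "\<bar>y $ i - t - p k / dyad al k\<bar> \<le> real (dyad al k) powr (- real m)" if "k \<in> J" for k
    proof -
      from that
      obtain j where k: "k = r + (m + j) * n" by (auto simp: J_def)
      have i: "e (k mod n) = i" using r by (simp add: k)
      have "m * 1 \<le> (m + j) * n" using n by (intro mult_mono) auto
      then have "m \<le> k" by (simp add: k)
      then have "real m \<le> al k" by (simp add: al_def)
      then have "real (dyad al k) powr (- al k) \<le> real (dyad al k) powr (- real m)"
        using dyad_ge_1[of al k] by (intro powr_mono) auto
      then show ?thesis
        using t(4)[of k] t(5)[of k] i powr_ge_zero[of "real (dyad al k)" "- al k"] by (simp add: abs_le_iff)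
    qed
    show ?thesis
      by (rule infinite_approximants_seq[OF J _ _ _ near])
         (use dyad_strict_mono[of al] al1 dyad_ge_1 odd_coprime_dyad t in auto)
  qed
  have "irrationality_exponent (y $ i - t) = \<infinity>" for i
  proof (rule ereal_top)
    fix B :: real
    obtain m :: nat where "B \<le> m" using real_arch_simple by blast
    then have "ereal B \<le> ereal (real m)" by simp
    also have "\<dots> \<le> irrationality_exponent (y $ i - t)" by (rule le_irrationality_exponent[OF inf])
    finally show "ereal B \<le> irrationality_exponent (y $ i - t)" .
  qed
  then show ?thesis using t that by blast
qed

subsection \<open>The lower bounds\<close>

text \<open>For diameters at most \<open>1\<close> a larger exponent gives a smaller power; for
  \<open>s = 0\<close> the weight is \<open>1\<close>, even at diameter \<open>0\<close>.\<close>

lemma powr_le_diam_weight: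
  assumes "U \<noteq> {}" "bounded U" "diameter U \<le> 1" "0 \<le> s" "s \<le> a" "0 < a"
  shows "ennreal (diameter U powr a) \<le> diam_weight s U"
proof -
  have d: "0 \<le> diameter U" by (rule diameter_ge_0[OF assms(2)])
  have "diameter U powr a \<le> diameter U powr s" using d assms by (intro powr_mono') auto
  moreover have "diameter U powr a \<le> 1" using d assms by (intro powr_le1) auto
  ultimately show ?thesis using assms(1) by (auto simp: diam_weight_def intro!: ennreal_leI)
qed

text \<open>Rounding \<open>t\<close> down to a multiple \<open>h * r\<close> puts every coordinate
  of the shifted point within \<open>2 * r\<close> of \<open>z $ i + h * r\<close>, so about
  \<open>1 / r\<close> cubes of side \<open>4 * r\<close> contain the sweep.\<close>

lemma emeasure_diagonal_sweep_le:
  fixes z :: "real ^ 'n" and r :: real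
  assumes r: "0 < r" "r \<le> 1"
  obtains V where "V \<in> sets borel"
    "emeasure lborel V \<le> ennreal (2 * 4 ^ CARD('n) * r ^ (CARD('n) - 1))"
    "\<And>x t. (\<And>i. \<bar>x $ i - z $ i\<bar> \<le> r) \<Longrightarrow> 0 \<le> t \<Longrightarrow> t \<le> 1 \<Longrightarrow> (\<chi> i. x $ i + t) \<in> V"
proof -
  define K where "K = nat \<lfloor>1 / r\<rfloor>"
  define B where "B h = cbox (\<chi> i. z $ i + real h * r - 2 * r) (\<chi> i. z $ i + real h * r + 2 * r)" for h :: nat
  define V where "V = (\<Union>h\<in>{..K}. B h)"
  have B: "emeasure lborel (B h) = ennreal ((4 * r) ^ CARD('n))" for h
  proof -
    have ne: "B h \<noteq> {}" unfolding B_def using r by (auto simp: interval_ne_empty_cart)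
    have "emeasure lborel (B h) = ennreal (measure lborel (B h))"
      unfolding B_def by (intro emeasure_eq_ennreal_measure) (simp add: emeasure_lborel_cbox_eq)
    also have "measure lborel (B h) = (\<Prod>i\<in>(UNIV::'n set). 4 * r)"
      unfolding B_def by (subst content_cbox_cart[OF ne[unfolded B_def]]) simp
    finally show ?thesis by simp
  qed
  have "emeasure lborel V \<le> (\<Sum>h\<in>{..K}. emeasure lborel (B h))"
    unfolding V_def by (intro emeasure_subadditive_finite) (auto simp: B_def)
  also have "\<dots> = ennreal (real (K + 1) * (4 * r) ^ CARD('n))"
    using r by (simp add: B ennreal_of_nat_eq_real_of_nat ennreal_mult[symmetric] algebra_simps)
  also have "\<dots> \<le> ennreal (2 * 4 ^ CARD('n) * r ^ (CARD('n) - 1))"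
  proof (rule ennreal_leI)
    have "real K \<le> 1 / r" using r unfolding K_def by simp
    moreover have "1 \<le> 1 / r" using r by simp
    ultimately have "real (K + 1) \<le> 1 / r + 1 / r" by linarith
    then have "real (K + 1) * (4 * r) ^ CARD('n) \<le> (1 / r + 1 / r) * (4 * r) ^ CARD('n)"
      using r by (intro mult_right_mono) auto
    also have "r ^ CARD('n) = r * r ^ (CARD('n) - 1)"
      using power_minus_mult[of "CARD('n)" r] by (simp add: mult.commute)
    then have "(1 / r + 1 / r) * (4 * r) ^ CARD('n) = 2 * 4 ^ CARD('n) * r ^ (CARD('n) - 1)"
      using r by (simp add: power_mult_distrib)
    finally show "real (K + 1) * (4 * r) ^ CARD('n) \<le> 2 * 4 ^ CARD('n) * r ^ (CARD('n) - 1)" .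
  qed
  finally have Vm: "emeasure lborel V \<le> ennreal (2 * 4 ^ CARD('n) * r ^ (CARD('n) - 1))" .
  have sweep: "(\<chi> i. x $ i + t) \<in> V" if x: "\<And>i. \<bar>x $ i - z $ i\<bar> \<le> r" and t: "0 \<le> t" "t \<le> 1" for x :: "real ^ 'n" and t
  proof -
    define h where "h = nat \<lfloor>t / r\<rfloor>"
    have "0 \<le> t / r" using t r by simp
    then have "real h \<le> t / r" "t / r < real h + 1" unfolding h_def by simp_all
    then have h: "real h * r \<le> t" "t < real h * r + r" using r by (simp_all add: field_simps)
    have "t / r \<le> 1 / r" using t r by (simp add: divide_right_mono)
    then have "h \<le> K" unfolding h_def K_def by (intro nat_mono floor_mono)
    moreover have "(\<chi> i. x $ i + t) \<in> B h"
    proof -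
      have "z $ i + real h * r - 2 * r \<le> x $ i + t \<and> x $ i + t \<le> z $ i + real h * r + 2 * r" for i
        using x[of i] h r by linarith
      then show ?thesis unfolding B_def by (simp add: mem_box_cart)
    qed
    ultimately show ?thesis unfolding V_def by blast
  qed
  have "V \<in> sets borel" unfolding V_def B_def by auto
  then show ?thesis using that Vm sweep by blast
qed

text \<open>A set of diameter \<open>r\<close> sweeps out a volume of order
  \<open>r ^ (n - 1)\<close> in dimension \<open>n\<close>. If \<open>s < n - 1\<close>, a cover of
  \<open>A\<close> of small weight, swept along the diagonal, would thus cover the unit cube with
  total volume below \<open>1\<close>.\<close>

lemma hausdorff_dim_diagonal_shifts:
  fixes A :: "(real ^ 'n::finite) set"
  assumes A: "\<And>y :: real ^ 'n. \<exists>t. 0 \<le> t \<and> t \<le> 1 \<and> (\<chi> i. y $ i - t) \<in> A"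
  shows "ereal (real CARD('n) - 1) \<le> hausdorff_dim A"
proof (rule hausdorff_dim_ge)
  fix s assume s0: "0 \<le> s" and null: "hausdorff_measure s A = 0"
  define d where "d = CARD('n) - 1"
  have d: "real d = real CARD('n) - 1" unfolding d_def using zero_less_card_finite[where 'a='n]
    by (simp add: of_nat_diff Suc_leI)
  have "real d \<le> s"
  proof (rule ccontr)
    assume "\<not> real d \<le> s"
    then have s: "s < real d" by simp
    then have d1: "d \<ge> 1" using s0 by (cases d) auto
    define c where "c = (2 * 4 ^ CARD('n) :: real)"
    have c: "c > 0" by (simp add: c_def)
    \<comment> \<open>This makes the final total \<open>c * (e + e)\<close> at most
      \<open>1 / 2\<close>.\<close>
    define e where "e = min 1 (1 / (4 * c))"
    have e: "e > 0" "e \<le> 1" "c * e \<le> 1 / 4" using c by (auto simp: e_def min_def field_simps)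
    have "hausdorff_premeasure s 1 A = 0" using null unfolding hausdorff_measure_eq_0_iff by simp
    then have "hausdorff_premeasure s 1 A < ennreal e" using e by simp
    then obtain U where U: "A \<subseteq> (\<Union>j::nat. U j)" "\<And>j. bounded (U j)" "\<And>j. diameter (U j) \<le> 1"
      "(\<Sum>j. diam_weight s (U j)) < ennreal e" by (rule hausdorff_premeasure_lessE) blast
    \<comment> \<open>Positive radii with sum \<open>e\<close>, which replace smaller diameters
      because a sweep needs a positive radius.\<close>
    define b where "b j = e * (1/2) ^ Suc j" for j
    have b: "b j > 0" "b j \<le> 1" for j
      using e power_le_one[of "1/2::real" j] mult_mono[of e 1 "(1/2) ^ Suc j" "1::real"] by (simp_all add: b_def)
    have "\<exists>V. V \<in> sets borel \<and> emeasure lborel V \<le> ennreal c * (diam_weight s (U j) + ennreal (b j)) \<and>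
       (\<forall>x t. x \<in> U j \<longrightarrow> 0 \<le> t \<longrightarrow> t \<le> 1 \<longrightarrow> (\<chi> i. x $ i + t) \<in> V)" for j
    proof (cases "U j = {}")
      case True then show ?thesis by (intro exI[of _ "{}"]) simp
    next
      case False
      then obtain z where z: "z \<in> U j" by blast
      define r where "r = max (diameter (U j)) (b j)"
      have diam: "0 \<le> diameter (U j)" by (rule diameter_ge_0[OF U(2)])
      have r: "0 < r" "r \<le> 1" using b[of j] U(3)[of j] by (auto simp: r_def)
      obtain V where V: "V \<in> sets borel" "emeasure lborel V \<le> ennreal (c * r ^ d)"
        "\<And>x t. (\<And>i. \<bar>x $ i - z $ i\<bar> \<le> r) \<Longrightarrow> 0 \<le> t \<Longrightarrow> t \<le> 1 \<Longrightarrow> (\<chi> i. x $ i + t) \<in> V"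
        using emeasure_diagonal_sweep_le[OF r, of z] unfolding c_def d_def by blast
      have "r ^ d \<le> diameter (U j) ^ d + b j"
      proof (cases "diameter (U j) \<le> b j")
        case True
        have "b j ^ d \<le> b j ^ 1" using b[of j] d1 by (intro power_decreasing) auto
        then show ?thesis using True diam by (simp add: r_def max_def add_increasing)
      next
        case False then show ?thesis using b[of j] by (simp add: r_def max_def)
      qed
      then have "c * r ^ d \<le> c * (diameter (U j) ^ d + b j)" using c by (intro mult_left_mono) auto
      then have "emeasure lborel V \<le> ennreal (c * (diameter (U j) ^ d + b j))"
        using V(2) by (meson ennreal_leI order_trans)
      also have "\<dots> = ennreal c * (ennreal (diameter (U j) ^ d) + ennreal (b j))"
        using c diam b[of j] by (simp add: ennreal_mult ennreal_plus less_imp_le)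
      also have "diameter (U j) ^ d = diameter (U j) powr real d"
        using diam d1 by (cases "diameter (U j) = 0") (auto simp: powr_realpow)
      also have "ennreal c * (ennreal (diameter (U j) powr real d) + ennreal (b j)) \<le>
         ennreal c * (diam_weight s (U j) + ennreal (b j))"
        using False U(2,3) s0 s d1 by (intro mult_left_mono add_mono powr_le_diam_weight) auto
      finally have Vm: "emeasure lborel V \<le> ennreal c * (diam_weight s (U j) + ennreal (b j))" .
      have "(\<chi> i. x $ i + t) \<in> V" if "x \<in> U j" "0 \<le> t" "t \<le> 1" for x t
      proof (rule V(3))
        fix i
        have "\<bar>x $ i - z $ i\<bar> \<le> norm (x - z)" using component_le_norm_cart[of "x - z" i] by simp
        also have "\<dots> \<le> diameter (U j)" using diameter_bounded_bound[OF U(2) that(1) z] by (simp add: dist_norm)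
        finally show "\<bar>x $ i - z $ i\<bar> \<le> r" by (simp add: r_def)
      qed (use that in auto)
      with V(1) Vm show ?thesis by blast
    qed
    then obtain V where V: "\<And>j. V j \<in> sets borel"
      "\<And>j. emeasure lborel (V j) \<le> ennreal c * (diam_weight s (U j) + ennreal (b j))"
      "\<And>j x t. x \<in> U j \<Longrightarrow> 0 \<le> t \<Longrightarrow> t \<le> 1 \<Longrightarrow> (\<chi> i. x $ i + t) \<in> V j"
      by metis
    have "cbox 0 1 \<subseteq> (\<Union>j. V j)"
    proof
      fix y :: "real ^ 'n"
      obtain t where t: "0 \<le> t" "t \<le> 1" "(\<chi> i. y $ i - t) \<in> A" using A by blast
      then obtain j where "(\<chi> i. y $ i - t) \<in> U j" using U(1) by blast
      from V(3)[OF this t(1,2)] have "y \<in> V j" by (simp add: vec_lambda_eta)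
      then show "y \<in> (\<Union>j. V j)" by blast
    qed
    then have "emeasure lborel (cbox 0 1 :: (real ^ 'n) set) \<le> emeasure lborel (\<Union>j. V j)"
      using V(1) by (intro emeasure_mono) auto
    also have "\<dots> \<le> (\<Sum>j. emeasure lborel (V j))"
      using V(1) by (intro emeasure_subadditive_countably) auto
    also have "\<dots> \<le> (\<Sum>j. ennreal c * (diam_weight s (U j) + ennreal (b j)))"
      by (intro suminf_le V) auto
    also have "\<dots> = ennreal c * ((\<Sum>j. diam_weight s (U j)) + (\<Sum>j. ennreal (b j)))"
      by (simp add: suminf_add[symmetric])
    also have "(\<Sum>j. ennreal (b j)) = ennreal e"
    proof -
      have "b sums (e * 1)" unfolding b_def by (intro sums_mult power_half_series)
      then show ?thesis using b by (intro suminf_ennreal_eq) (auto intro: less_imp_le)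
    qed
    also have "ennreal c * ((\<Sum>j. diam_weight s (U j)) + ennreal e) \<le> ennreal c * (ennreal e + ennreal e)"
      using U(4) by (intro mult_left_mono add_mono) auto
    also have "\<dots> = ennreal (2 * (c * e))" using c e by (simp add: ennreal_mult[symmetric] ennreal_plus[symmetric] algebra_simps del: ennreal_plus)
    also have "\<dots> \<le> ennreal (1 / 2)" using e by (intro ennreal_leI) auto
    finally have "emeasure lborel (cbox 0 1 :: (real ^ 'n) set) \<le> ennreal (1 / 2)" .
    moreover have "emeasure lborel (cbox 0 1 :: (real ^ 'n) set) = 1"
    proof -
      have ne: "cbox 0 1 \<noteq> ({} :: (real ^ 'n) set)" by (auto simp: interval_ne_empty_cart)
      have "emeasure lborel (cbox 0 1 :: (real ^ 'n) set) = ennreal (measure lborel (cbox 0 1 :: (real ^ 'n) set))"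
        by (intro emeasure_eq_ennreal_measure) (simp add: emeasure_lborel_cbox_eq)
      also have "measure lborel (cbox 0 1 :: (real ^ 'n) set) = 1"
        by (subst content_cbox_cart[OF ne]) simp
      finally show ?thesis by simp
    qed
    ultimately have "ennreal 1 \<le> ennreal (1 / 2)" by simp
    then show False by (subst (asm) ennreal_le_iff) auto
  qed
  then show "ereal (real CARD('n) - 1) \<le> ereal s" using d by simp
qed

text \<open>The mass distribution principle: a set of diameter \<open>r\<close> lies in a cube of
  side \<open>2 * r\<close>, whose product mass is at most \<open>K * r powr a\<close>. For
  \<open>s < a\<close> a cover of small weight would leave total mass below \<open>1\<close>. The
  cubes stand in for the sets \<open>U j\<close>, which may fail to be measurable.\<close>

lemma hausdorff_null_product_ge:
  fixes M :: "'n::finite \<Rightarrow> real measure" and S :: "'n \<Rightarrow> real" and A :: "(real ^ 'n) set"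
  assumes prob: "\<And>i. prob_space (M i)" and borel: "\<And>i. sets (M i) = sets borel"
    and S: "\<And>i. S i > 0"
    and bd: "\<And>i. \<exists>C\<ge>0. \<forall>x l. 0 \<le> l \<longrightarrow> measure (M i) {x..x + l} \<le> C * l powr S i"
    and AE: "\<And>i. AE x in M i. x \<in> W i" and A: "\<And>x. (\<And>i. x $ i \<in> W i) \<Longrightarrow> x \<in> A"
    and null: "hausdorff_measure s A = 0" "0 \<le> s"
  shows "(\<Sum>i\<in>UNIV. S i) \<le> s"
proof (rule ccontr)
  define a where "a = (\<Sum>i\<in>UNIV. S i)"
  assume "\<not> ?thesis"
  then have s: "s < a" by (simp add: a_def)
  then have a0: "a > 0" using null by simp
  obtain C where C: "\<And>i. C i \<ge> 0" "\<And>i x l. 0 \<le> l \<Longrightarrow> measure (M i) {x..x + l} \<le> C i * l powr S i"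
    using bd by metis
  define K where "K = (\<Prod>i\<in>UNIV. C i * 2 powr S i)"
  have K: "K \<ge> 0" unfolding K_def using C by (intro prod_nonneg) auto
  define N where "N = PiM UNIV M"
  interpret product_prob_space M UNIV by (rule product_prob_spaceI) (rule prob)
  interpret N: prob_space N unfolding N_def by (rule prob_space_PiM) (rule prob)
  have space: "space N = UNIV"
    unfolding N_def space_PiM using sets_eq_imp_space_eq[OF borel] by (auto simp: PiE_UNIV_domain)
  have "hausdorff_premeasure s 1 A = 0" using null unfolding hausdorff_measure_eq_0_iff by simp
  \<comment> \<open>The bound \<open>1 / (K + 1)\<close> is meaningful also for \<open>K = 0\<close>
    and gives the total \<open>K / (K + 1) < 1\<close>.\<close>
  then have "hausdorff_premeasure s 1 A < ennreal (1 / (K + 1))" using K by simp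
  then obtain U where U: "A \<subseteq> (\<Union>j::nat. U j)" "\<And>j. bounded (U j)" "\<And>j. diameter (U j) \<le> 1"
    "(\<Sum>j. diam_weight s (U j)) < ennreal (1 / (K + 1))" by (rule hausdorff_premeasure_lessE) blast
  have "\<exists>B. B \<in> sets N \<and> emeasure N B \<le> ennreal K * diam_weight s (U j) \<and>
      (\<forall>w. (\<chi> i. w i) \<in> U j \<longrightarrow> w \<in> B)" for j
  proof (cases "U j = {}")
    case True then show ?thesis by (intro exI[of _ "{}"]) simp
  next
    case False
    then obtain z where z: "z \<in> U j" by blast
    define r where "r = diameter (U j)"
    have r: "r \<ge> 0" unfolding r_def by (rule diameter_ge_0[OF U(2)])
    define B where "B = PiE UNIV (\<lambda>i. {z $ i - r..z $ i - r + 2 * r})"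
    have "emeasure N B = (\<Prod>i\<in>UNIV. emeasure (M i) {z $ i - r..z $ i - r + 2 * r})"
      unfolding N_def B_def by (rule emeasure_PiM) (auto simp: borel)
    also have "\<dots> = (\<Prod>i\<in>UNIV. ennreal (measure (M i) {z $ i - r..z $ i - r + 2 * r}))"
      by (simp add: M.emeasure_eq_measure)
    also have "\<dots> = ennreal (\<Prod>i\<in>UNIV. measure (M i) {z $ i - r..z $ i - r + 2 * r})"
      by (intro prod_ennreal) simp
    also have "\<dots> \<le> ennreal (\<Prod>i\<in>UNIV. C i * (2 * r) powr S i)"
      using r by (intro ennreal_leI prod_mono conjI C(2)) auto
    also have "(\<Prod>i\<in>UNIV. C i * (2 * r) powr S i) = K * r powr a"
    proof -
      have "(\<Prod>i\<in>UNIV. C i * (2 * r) powr S i) = (\<Prod>i\<in>UNIV. (C i * 2 powr S i) * r powr S i)"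
        using r by (intro prod.cong) (auto simp: powr_mult)
      also have "\<dots> = K * (\<Prod>i\<in>UNIV. r powr S i)" by (simp add: prod.distrib K_def)
      also have "(\<Prod>i\<in>UNIV. r powr S i) = r powr a"
        using r a0 S by (cases "r = 0") (auto simp: a_def powr_sum)
      finally show ?thesis .
    qed
    also have "ennreal (K * r powr a) = ennreal K * ennreal (r powr a)" using K by (simp add: ennreal_mult)
    also have "\<dots> \<le> ennreal K * diam_weight s (U j)"
      unfolding r_def using False U(2,3) null s a0 by (intro mult_left_mono powr_le_diam_weight) auto
    finally have Bm: "emeasure N B \<le> ennreal K * diam_weight s (U j)" .
    have "w \<in> B" if w: "(\<chi> i. w i) \<in> U j" for w
    proof -
      have "\<bar>w i - z $ i\<bar> \<le> r" for i
      proof -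
        have "\<bar>w i - z $ i\<bar> \<le> norm ((\<chi> i. w i) - z)" using component_le_norm_cart[of "(\<chi> i. w i) - z" i] by simp
        also have "\<dots> \<le> r" unfolding r_def using diameter_bounded_bound[OF U(2) w z] by (simp add: dist_norm)
        finally show ?thesis .
      qed
      then show ?thesis unfolding B_def by (auto simp: abs_le_iff algebra_simps)
    qed
    moreover have "B \<in> sets N" unfolding N_def B_def by (intro sets_PiM_I_finite) (auto simp: borel)
    ultimately show ?thesis using Bm by blast
  qed
  then obtain B where B: "\<And>j. B j \<in> sets N" "\<And>j. emeasure N (B j) \<le> ennreal K * diam_weight s (U j)"
    "\<And>j w. (\<chi> i. w i) \<in> U j \<Longrightarrow> w \<in> B j"
    by metis
  have "AE w in N. \<forall>i\<in>UNIV. w i \<in> W i"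
    unfolding N_def by (intro AE_finite_allI AE_PiM_component prob AE) auto
  then have "AE w in N. w \<in> (\<Union>j. B j)"
  proof eventually_elim
    fix w assume "\<forall>i\<in>UNIV. w i \<in> W i"
    then have "(\<chi> i. w i) \<in> A" by (intro A) simp
    then show "w \<in> (\<Union>j. B j)" using U(1) B(3) by blast
  qed
  then have "1 = emeasure N (\<Union>j. B j)"
    using B(1) by (intro N.emeasure_eq_1_AE[symmetric]) auto
  also have "\<dots> \<le> (\<Sum>j. emeasure N (B j))"
    using B(1) by (intro emeasure_subadditive_countably) auto
  also have "\<dots> \<le> (\<Sum>j. ennreal K * diam_weight s (U j))" by (intro suminf_le B) auto
  also have "\<dots> = ennreal K * (\<Sum>j. diam_weight s (U j))" by simp
  also have "\<dots> \<le> ennreal K * ennreal (1 / (K + 1))" using U(4) by (intro mult_left_mono) auto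
  also have "\<dots> = ennreal (K / (K + 1))" using K by (simp add: ennreal_mult[symmetric])
  finally have "ennreal 1 \<le> ennreal (K / (K + 1))" by simp
  then show False using K by (subst (asm) ennreal_le_iff) auto
qed

section \<open>Extended real exponents and combination of the bounds\<close>

lemma hausdorff_measure_mono: "A \<subseteq> B \<Longrightarrow> hausdorff_measure s A \<le> hausdorff_measure s B"
  unfolding hausdorff_measure_def by (intro SUP_mono') (rule hausdorff_premeasure_mono)

text \<open>The remaining factors have product at least \<open>1\<close>, so
  \<open>\<infinity>\<close> is multiplied by a positive number.\<close>

lemma ereal_prod_eq_PInfty:
  fixes f :: "'a \<Rightarrow> ereal"
  assumes "finite S" "\<And>j. j \<in> S \<Longrightarrow> 1 \<le> f j" "j \<in> S" "f j = \<infinity>"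
  shows "(\<Prod>j\<in>S. f j) = \<infinity>"
proof -
  have ge: "1 \<le> (\<Prod>j\<in>T. f j)" if "finite T" "T \<subseteq> S" for T
    using that
  proof (induction T rule: finite_induct)
    case (insert x T)
    then have "1 \<le> f x" "1 \<le> (\<Prod>j\<in>T. f j)" using assms(2) by auto
    then have "1 * 1 \<le> f x * (\<Prod>j\<in>T. f j)" by (intro ereal_mult_mono) (auto intro: order_trans[of 0 1])
    then show ?case using insert by simp
  qed simp
  have "1 \<le> (\<Prod>j\<in>S - {j}. f j)" using ge[of "S - {j}"] assms(1) by auto
  then have "0 < (\<Prod>j\<in>S - {j}. f j)" by (rule less_le_trans[rotated]) simp
  then show ?thesis using assms by (simp add: prod.remove[of S j])
qed

text \<open>With \<open>n\<close> the dimension, any \<open>s\<close> above the bound admits a real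
  \<open>m < a\<close> with \<open>n - 1 + 2 / m < s\<close>; this includes
  \<open>a = \<infinity>\<close>, where \<open>2 / a = 0\<close>.\<close>

lemma hausdorff_dim_exponent_le:
  fixes A :: "(real ^ 'n::finite) set" and a :: ereal
  assumes a: "0 < a" and A: "\<And>x. x \<in> A \<Longrightarrow> a \<le> irrationality_exponent (x $ i)"
  shows "hausdorff_dim A \<le> ereal (real CARD('n) - 1) + 2 / a"
proof (rule ccontr)
  assume "\<not> ?thesis"
  then have "ereal (real CARD('n) - 1) + 2 / a < hausdorff_dim A" by (simp only: not_le)
  then obtain s where s: "ereal (real CARD('n) - 1) + 2 / a < ereal s" "ereal s < hausdorff_dim A"
    using ereal_dense2 by blast
  define w where "w = s - (real CARD('n) - 1)"
  have n1: "real CARD('n) \<ge> 1" using zero_less_card_finite[where 'a='n] by linarith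
  have w: "w > 0 \<and> ereal (2 / w) < a"
  proof (cases a)
    case (real r)
    then have r: "r > 0" using a by simp
    have "2 / a = ereal (2 / r)" using r unfolding real numeral_eq_ereal by simp
    then have "2 / r < w" using s(1) by (simp add: w_def)
    moreover have "0 < 2 / r" using r by simp
    ultimately have "0 < w" by linarith
    with \<open>2 / r < w\<close> r show ?thesis unfolding real by (simp add: field_simps)
  next
    case PInf then show ?thesis using s(1) by (simp add: w_def)
  qed (use a in auto)
  then obtain m where m: "ereal (2 / w) < ereal m" "ereal m < a" using ereal_dense2 by blast
  have "0 < 2 / w" using w by simp
  moreover have "2 / w < m" using m(1) by simp
  ultimately have m0: "m > 0" "2 / w < m" by linarith+
  then have "2 / m < w" using w by (simp add: field_simps)
  then have "hausdorff_measure s {x :: real ^ 'n. infinite (approximants (x $ i) m)} = 0"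
    using m0 by (intro hausdorff_measure_well_approximable) (auto simp: w_def)
  moreover have "A \<subseteq> {x :: real ^ 'n. infinite (approximants (x $ i) m)}"
  proof clarify
    fix x assume "x \<in> A" "finite (approximants (x $ i) m)"
    then show False using less_irrationality_exponent[OF less_le_trans[OF m(2) A]] by blast
  qed
  ultimately have "hausdorff_measure s A = 0"
    using hausdorff_measure_mono[of A] by (metis le_zero_eq)
  moreover have "0 \<le> s" using w n1 unfolding w_def by linarith
  ultimately show False using hausdorff_dim_le s(2) by (metis not_le)
qed

text \<open>The mass bound holds for exponents strictly below \<open>2 / lam i\<close>; therefore
  they are scaled by \<open>c < 1\<close>, and \<open>c\<close> tends to \<open>1\<close>.\<close>

lemma hausdorff_dim_exact_order_product_ge:
  fixes A :: "(real ^ 'n::finite) set" and lam :: "'n \<Rightarrow> real"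
  assumes lam: "\<And>i. 2 \<le> lam i" and A: "\<And>x. (\<And>i. irrationality_exponent (x $ i) = ereal (lam i)) \<Longrightarrow> x \<in> A"
  shows "ereal (2 * (\<Sum>i\<in>UNIV. 1 / lam i)) \<le> hausdorff_dim A"
proof (rule hausdorff_dim_ge)
  fix s assume s: "0 \<le> s" "hausdorff_measure s A = 0"
  have lam0: "lam i > 0" for i using lam[of i] by linarith
  have "\<exists>M :: real measure. prob_space M \<and> sets M = sets borel \<and>
    (\<forall>s. 0 < s \<longrightarrow> s < 2 / lam i \<longrightarrow> (\<exists>C\<ge>0. \<forall>x l. 0 \<le> l \<longrightarrow> measure M {x..x + l} \<le> C * l powr s)) \<and>
    (AE x in M. irrationality_exponent x = ereal (lam i))" for i
    by (rule ex_exact_order_measure[OF lam[of i]]) blast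
  then obtain M :: "'n \<Rightarrow> real measure" where M: "\<And>i. prob_space (M i)" "\<And>i. sets (M i) = sets borel"
    "\<And>i s. 0 < s \<Longrightarrow> s < 2 / lam i \<Longrightarrow> \<exists>C\<ge>0. \<forall>x l. 0 \<le> l \<longrightarrow> measure (M i) {x..x + l} \<le> C * l powr s"
    "\<And>i. AE x in M i. irrationality_exponent x = ereal (lam i)"
    by metis
  have "c * (2 * (\<Sum>i\<in>UNIV. 1 / lam i)) \<le> s" if c: "0 < c" "c < 1" for c
  proof -
    have "(\<Sum>i\<in>UNIV. c * (2 / lam i)) \<le> s"
    proof (rule hausdorff_null_product_ge[where M=M and W="\<lambda>i. {x. irrationality_exponent x = ereal (lam i)}"])
      fix i
      show "c * (2 / lam i) > 0" using c lam0[of i] by simp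
      have "c * (2 / lam i) < 1 * (2 / lam i)" using c lam0[of i] by (intro mult_strict_right_mono) auto
      then show "\<exists>C\<ge>0. \<forall>x l. 0 \<le> l \<longrightarrow> measure (M i) {x..x + l} \<le> C * l powr (c * (2 / lam i))"
        using \<open>c * (2 / lam i) > 0\<close> by (intro M) auto
    qed (use M s A in auto)
    then show ?thesis by (simp add: sum_distrib_left)
  qed
  then have "2 * (\<Sum>i\<in>UNIV. 1 / lam i) \<le> s" by (rule field_le_mult_one_interval)
  then show "ereal (2 * (\<Sum>i\<in>UNIV. 1 / lam i)) \<le> ereal s" by simp
qed

theorem theorem3p4:
  fixes l u :: "'n::finite \<Rightarrow> ereal"
  assumes "\<And>i. 2 \<le> l i"
    and "\<And>i. l i \<le> u i"
    and "\<And>i. u i > (\<Prod>j\<in>UNIV. l j) / (l i - 1) + 1"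
  shows "ereal (real CARD('n) - 1) + 2 / Max (range l)
           \<ge> hausdorff_dim {x :: real ^ 'n. \<forall>i. x $ i \<in> exponent_class (l i) (u i)}
       \<and> hausdorff_dim {x :: real ^ 'n. \<forall>i. x $ i \<in> exponent_class (l i) (u i)}
           \<ge> max (ereal (real CARD('n) - 1)) (2 * (\<Sum>i\<in>UNIV. 1 / l i))"
proof -
  let ?A = "{x :: real ^ 'n. \<forall>i. x $ i \<in> exponent_class (l i) (u i)}"
  have mem: "x \<in> ?A" if "\<And>i. l i \<le> irrationality_exponent (x $ i)" "\<And>i. irrationality_exponent (x $ i) \<le> u i"
    for x :: "real ^ 'n"
    using that by (simp add: exponent_class_def)
  \<comment> \<open>The coordinate with the largest \<open>l i\<close> gives the best upper
    bound.\<close>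
  have "Max (range l) \<in> range l" by (intro Max_in) auto
  then obtain i where i: "l i = Max (range l)" by (metis imageE)
  have "hausdorff_dim ?A \<le> ereal (real CARD('n) - 1) + 2 / l i"
  proof (rule hausdorff_dim_exponent_le[where i=i])
    show "0 < l i" using assms(1)[of i] by (rule less_le_trans[rotated]) simp
  qed (simp add: exponent_class_def)
  moreover have "ereal (real CARD('n) - 1) \<le> hausdorff_dim ?A \<and> 2 * (\<Sum>i\<in>UNIV. 1 / l i) \<le> hausdorff_dim ?A"
  proof (cases "\<exists>j. l j = \<infinity>")
    case True
    then obtain j where j: "l j = \<infinity>" by blast
    have "1 \<le> l i" for i using assms(1)[of i] by (rule order_trans[rotated]) simp
    then have Lam: "(\<Prod>j\<in>UNIV. l j) = \<infinity>" using j by (intro ereal_prod_eq_PInfty[of _ _ j]) auto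
    have inf: "l i = \<infinity>" for i
    proof (cases "l i")
      case (real a)
      then have "a \<ge> 2" using assms(1)[of i] by simp
      \<comment> \<open>A finite \<open>l i\<close> would thus demand
        \<open>u i > \<infinity>\<close>.\<close>
      then have "(\<Prod>j\<in>UNIV. l j) / (l i - 1) = \<infinity>"
        unfolding Lam real by (simp add: one_ereal_def)
      then show ?thesis using assms(3)[of i] by simp
    qed (use assms(1)[of i] in auto)
    then have u: "u i = \<infinity>" for i using assms(2)[of i] by simp
    have "ereal (real CARD('n) - 1) \<le> hausdorff_dim ?A"
    proof (rule hausdorff_dim_diagonal_shifts)
      fix y :: "real ^ 'n"
      obtain t where "0 \<le> t" "t \<le> 1" "\<And>i. irrationality_exponent (y $ i - t) = \<infinity>"
        using shift_into_liouville[of y] by blast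
      then show "\<exists>t. 0 \<le> t \<and> t \<le> 1 \<and> (\<chi> i. y $ i - t) \<in> ?A"
        by (intro exI[of _ t] conjI mem) (auto simp: u)
    qed
    moreover have "2 * (\<Sum>i\<in>UNIV. 1 / l i) = 0" by (simp add: inf)
    moreover have "0 \<le> hausdorff_dim ?A" by (rule hausdorff_dim_ge) simp
    ultimately show ?thesis by simp
  next
    case False
    define lam where "lam i = real_of_ereal (l i)" for i
    have l: "l i = ereal (lam i)" for i
      using False assms(1)[of i] unfolding lam_def by (cases "l i") auto
    have lam: "lam i \<ge> 2" for i using assms(1)[of i] unfolding l by simp
    \<comment> \<open>Together the two hypotheses on \<open>u i\<close> dominate the exponent bound
      that the shift provides.\<close>
    have u: "ereal (max (lam i) ((\<Prod>j\<in>UNIV. lam j) / (lam i - 1) + 1)) \<le> u i" for i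
    proof -
      have "(\<Prod>j\<in>UNIV. l j) / (l i - 1) + 1 = ereal ((\<Prod>j\<in>UNIV. lam j) / (lam i - 1) + 1)"
        using lam[of i] unfolding l by (simp add: one_ereal_def prod_ereal)
      then show ?thesis using assms(2)[of i] assms(3)[of i] unfolding l by (simp add: max_def less_imp_le)
    qed
    have "ereal (real CARD('n) - 1) \<le> hausdorff_dim ?A"
    proof (rule hausdorff_dim_diagonal_shifts)
      fix y :: "real ^ 'n"
      obtain t where t: "0 \<le> t" "t \<le> 1" "\<And>i. ereal (lam i) \<le> irrationality_exponent (y $ i - t)"
        "\<And>i. irrationality_exponent (y $ i - t) \<le> ereal (max (lam i) ((\<Prod>j\<in>UNIV. lam j) / (lam i - 1) + 1))"
        using shift_into_exponent_classes[of lam y] lam by blast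
      have "l i \<le> irrationality_exponent (y $ i - t)" "irrationality_exponent (y $ i - t) \<le> u i" for i
        using t(3)[of i] order_trans[OF t(4) u, of i] unfolding l by this+
      then show "\<exists>t. 0 \<le> t \<and> t \<le> 1 \<and> (\<chi> i. y $ i - t) \<in> ?A"
        using t(1,2) by (intro exI[of _ t] conjI mem) simp_all
    qed
    moreover have "ereal (2 * (\<Sum>i\<in>UNIV. 1 / lam i)) \<le> hausdorff_dim ?A"
    proof (rule hausdorff_dim_exact_order_product_ge[OF lam])
      fix x :: "real ^ 'n" assume "\<And>i. irrationality_exponent (x $ i) = ereal (lam i)"
      then show "x \<in> ?A" using assms(2) by (intro mem) (auto simp: l)
    qed
    moreover have "ereal (2 * (\<Sum>i\<in>UNIV. 1 / lam i)) = 2 * (\<Sum>i\<in>UNIV. 1 / l i)"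
    proof -
      have "1 / l i = ereal (1 / lam i)" for i using lam[of i] unfolding l one_ereal_def by simp
      then have "(\<Sum>i\<in>UNIV. 1 / l i) = ereal (\<Sum>i\<in>UNIV. 1 / lam i)" by (simp add: sum_ereal)
      then show ?thesis unfolding numeral_eq_ereal by simp
    qed
    ultimately show ?thesis by simp
  qed
  ultimately show ?thesis unfolding i by simp
qed

end
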